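(* Let $n\ge 3$. Consider the diagram of groups with rows $$1\to A\to G\to W\to 1,$$ $$1\to M^*\xrightarrow{\,t\,}\operatorname{Aut}(G)\xrightarrow{\,\pi\,}\operatorname{Aut}(W)\to 1,$$ $$1\to M^*/\iota(A)\to \operatorname{Out}(G)\to\operatorname{Out}(W)\to 1,$$ and columns $$1\to A\xrightarrow{\,\iota\,}M^*\to M^*/\iota(A)\to 1,\qquad 1\to G\to\operatorname{Aut}(G)\to\operatorname{Out}(G)\to 1,\qquad 1\to W\to\operatorname{Aut}(W)\to\operatorname{Out}(W)\to 1 .$$ This $3\times 3$ diagram is commutative, and every row and every column is exact.
   Context: For a positive integer $n$ let $G=\langle x_1,\dots,x_n\mid x_i^{-1}x_j^2x_i=x_j^{-2}\ \text{for all } i\ne j\rangle$. Let $A=\langle x_1^2,\dots,x_n^2\rangle\le G$; it is known that $A$ is normal and free abelian with basis $x_1^2,\dots,x_n^2$. Let $W=G/A$, which is the free product of the $n$ groups $\langle\bar x_i\rangle\cong C_2$ ($\bar x_i=x_iA$). For $n\ge 3$ the subgroup $A$ is characteristic in $G$. Let $M=M_n(\mathbb Z)$ with the binary operation $[a_{ij}]*[b_{ij}]=[c_{ij}]$, $c_{ij}=a_{ij}+(1+2a_{jj})b_{ij}$; this is a monoid with identity the zero matrix, and $M^*$ denotes its group of units. For $\mathfrak a=[a_{ij}]\in M$, $t_{\mathfrak a}$ is the unique endomorphism of $G$ with $t_{\mathfrak a}(x_i)=x_i(x_1^2)^{a_{i1}}\cdots(x_n^2)^{a_{in}}$ for all $i$,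 and $t$ is the map $\mathfrak a\mapsto t_{\mathfrak a}$. The map $\iota:A\to M^*$ sends $(x_1^2)^{a_1}\cdots(x_n^2)^{a_n}$ to the matrix $[a_{ij}]$ with $a_{ii}=0$ and $a_{ij}=-2a_j$ for $i\ne j$; thus $t_{\iota(a)}$ is the conjugation $g\mapsto aga^{-1}$. The map $\pi$ sends an automorphism of $G$ to the automorphism it induces on $W=G/A$. The maps $G\to\operatorname{Aut}(G)$ and $W\to\operatorname{Aut}(W)$ send an element $g$ to the conjugation $h\mapsto ghg^{-1}$. The maps $A\to G$, $G\to W$, $M^*\to M^*/\iota(A)$, $\operatorname{Aut}\to\operatorname{Out}$ are the inclusion and the canonical projections. The maps of the bottom row are induced by those of the middle row: $\mathfrak a\,\iota(A)\mapsto t_{\mathfrak a}\operatorname{Inn}(G)$ and $\varphi\operatorname{Inn}(G)\mapsto\pi(\varphi)\operatorname{Inn}(W)$. *)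

theory Defs
  imports "HOL-Algebra.Algebra" "Jordan_Normal_Form.Matrix"
begin

section \<open>Groups given by generators and relations\<close>

text \<open>A letter \<open>(s, False)\<close> stands for the generator \<open>s\<close>, and \<open>(s, True)\<close> for its formal inverse.
  A relation \<open>u = v\<close> is the pair \<open>(u, v)\<close>.\<close>

type_synonym 's word = "('s \<times> bool) list"

inductive pres_eq :: "'s set \<Rightarrow> ('s word \<times> 's word) set \<Rightarrow> 's word \<Rightarrow> 's word \<Rightarrow> bool"
  for S R where
  refl: "u \<in> lists (S \<times> UNIV) \<Longrightarrow> pres_eq S R u u"
| sym: "pres_eq S R u v \<Longrightarrow> pres_eq S R v u"
| trans: "pres_eq S R u v \<Longrightarrow> pres_eq S R v w \<Longrightarrow> pres_eq S R u w"
| append: "pres_eq S R u v \<Longrightarrow> pres_eq S R u' v' \<Longrightarrow> pres_eq S R (u @ u') (v @ v')"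
| cancel: "s \<in> S \<Longrightarrow> pres_eq S R [(s, b), (s, \<not> b)] []"
| relation: "(u, v) \<in> R \<Longrightarrow> u \<in> lists (S \<times> UNIV) \<Longrightarrow> v \<in> lists (S \<times> UNIV) \<Longrightarrow> pres_eq S R u v"

definition pres_class :: "'s set \<Rightarrow> ('s word \<times> 's word) set \<Rightarrow> 's word \<Rightarrow> 's word set" where
  "pres_class S R u = {v. pres_eq S R u v}"

definition presented_group :: "'s set \<Rightarrow> ('s word \<times> 's word) set \<Rightarrow> 's word set monoid" where
  "presented_group S R =
    \<lparr>carrier = pres_class S R ` lists (S \<times> UNIV),
     monoid.mult = (\<lambda>U V. \<Union>u\<in>U. \<Union>v\<in>V. pres_class S R (u @ v)),
     one = pres_class S R []\<rparr>"


section \<open>Exactness, quotients and automorphisms\<close>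

text \<open>Exactness of \<open>1 \<rightarrow> K \<rightarrow> H \<rightarrow> Q \<rightarrow> 1\<close> at each of the three terms. The library's
  \<open>exact_seq\<close> and \<open>short_exact_sequence\<close> need all groups of a
  sequence to have the same element type.\<close>

definition group_short_exact ::
  "('a, 'k) monoid_scheme \<Rightarrow> ('a \<Rightarrow> 'b) \<Rightarrow> ('b, 'l) monoid_scheme \<Rightarrow> ('b \<Rightarrow> 'c) \<Rightarrow>
    ('c, 'm) monoid_scheme \<Rightarrow> bool" where
  "group_short_exact K f H g Q \<longleftrightarrow>
     group_hom K H f \<and> group_hom H Q g \<and>
     kernel K H f = {\<one>\<^bsub>K\<^esub>} \<and>
     f ` carrier K = kernel H Q g \<and>
     g ` carrier H = carrier Q"

definition quot_map :: "('a, 'm) monoid_scheme \<Rightarrow> 'a set \<Rightarrow> 'a \<Rightarrow> 'a set" where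
  "quot_map G N g = N #>\<^bsub>G\<^esub> g"

text \<open>The map \<open>G / N \<rightarrow> H / K\<close>, \<open>g N \<mapsto> f(g) K\<close>, induced by \<open>f\<close> with \<open>f(N) \<subseteq> K\<close>: the image of the
  coset \<open>C\<close> under \<open>g \<mapsto> f(g) K\<close> is a singleton.\<close>

definition induced_map :: "('a, 'm) monoid_scheme \<Rightarrow> 'a set \<Rightarrow> ('b, 'n) monoid_scheme \<Rightarrow> 'b set \<Rightarrow>
    ('a \<Rightarrow> 'b) \<Rightarrow> 'a set \<Rightarrow> 'b set" where
  "induced_map G N H K f =
     (\<lambda>C \<in> carrier (G Mod N). the_elem ((\<lambda>g. quot_map H K (f g)) ` C))"

definition conj_aut :: "('a, 'm) monoid_scheme \<Rightarrow> 'a \<Rightarrow> 'a \<Rightarrow> 'a" where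
  "conj_aut G g = (\<lambda>h \<in> carrier G. g \<otimes>\<^bsub>G\<^esub> h \<otimes>\<^bsub>G\<^esub> inv\<^bsub>G\<^esub> g)"

definition Inn :: "('a, 'm) monoid_scheme \<Rightarrow> ('a \<Rightarrow> 'a) set" where
  "Inn G = conj_aut G ` carrier G"

definition OutGroup :: "('a, 'm) monoid_scheme \<Rightarrow> ('a \<Rightarrow> 'a) set monoid" where
  "OutGroup G = AutoGroup G Mod Inn G"


section \<open>The groups \<open>G\<close>, \<open>A\<close>, \<open>W\<close>\<close>

text \<open>The generators are indexed by \<open>0, \<dots>, n - 1\<close>, as are rows and columns of matrices.\<close>

definition G_relations :: "nat \<Rightarrow> (nat word \<times> nat word) set" where
  "G_relations n =
    {([(i, True), (j, False), (j, False), (i, False)], [(j, True), (j, True)]) | i j.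
       i < n \<and> j < n \<and> i \<noteq> j}"

definition G_group :: "nat \<Rightarrow> nat word set monoid" where
  "G_group n = presented_group {..<n} (G_relations n)"

definition x_gen :: "nat \<Rightarrow> nat \<Rightarrow> nat word set" where
  "x_gen n i = pres_class {..<n} (G_relations n) [(i, False)]"

definition x_sq :: "nat \<Rightarrow> nat \<Rightarrow> nat word set" where
  "x_sq n i = x_gen n i [^]\<^bsub>G_group n\<^esub> (2::nat)"

definition A_set :: "nat \<Rightarrow> nat word set set" where
  "A_set n = generate (G_group n) (x_sq n ` {..<n})"

definition A_group :: "nat \<Rightarrow> nat word set monoid" where
  "A_group n = (G_group n)\<lparr>carrier := A_set n\<rparr>"

definition W_group :: "nat \<Rightarrow> nat word set set monoid" where
  "W_group n = G_group n Mod A_set n"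

text \<open>The ordered product of the powers \<open>(x\<^sub>j\<^sup>2)\<close> to the \<open>c j\<close>.\<close>

definition sq_prod :: "nat \<Rightarrow> (nat \<Rightarrow> int) \<Rightarrow> nat word set" where
  "sq_prod n c =
     foldr (\<otimes>\<^bsub>G_group n\<^esub>) (map (\<lambda>j. x_sq n j [^]\<^bsub>G_group n\<^esub> c j) [0..<n]) \<one>\<^bsub>G_group n\<^esub>"


section \<open>The monoid \<open>M\<close> and the maps \<open>t\<close>, \<open>\<iota>\<close>, \<open>\<pi>\<close>\<close>

definition M_monoid :: "nat \<Rightarrow> int mat monoid" where
  "M_monoid n =
    \<lparr>carrier = carrier_mat n n,
     monoid.mult = (\<lambda>a b. mat n n (\<lambda>(i, j). a $$ (i, j) + (1 + 2 * a $$ (j, j)) * b $$ (i, j))),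
     one = 0\<^sub>m n n\<rparr>"

definition M_units :: "nat \<Rightarrow> int mat monoid" where
  "M_units n = units_of (M_monoid n)"

definition t_map :: "nat \<Rightarrow> int mat \<Rightarrow> nat word set \<Rightarrow> nat word set" where
  "t_map n a =
    (THE f. f \<in> hom (G_group n) (G_group n) \<and> f \<in> extensional (carrier (G_group n)) \<and>
       (\<forall>i<n. f (x_gen n i) = x_gen n i \<otimes>\<^bsub>G_group n\<^esub> sq_prod n (\<lambda>j. a $$ (i, j))))"

text \<open>The exponents of an element of \<open>A\<close> are unique since \<open>A\<close> is free abelian on the \<open>x\<^sub>j\<^sup>2\<close>.\<close>

definition iota :: "nat \<Rightarrow> nat word set \<Rightarrow> int mat" where
  "iota n g =
    (THE m. \<exists>c. g = sq_prod n c \<and> m = mat n n (\<lambda>(i, j). if i = j then 0 else - 2 * c j))"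

definition iota_image :: "nat \<Rightarrow> int mat set" where
  "iota_image n = iota n ` A_set n"

definition pi_map :: "nat \<Rightarrow> (nat word set \<Rightarrow> nat word set) \<Rightarrow> nat word set set \<Rightarrow> nat word set set" where
  "pi_map n \<phi> = induced_map (G_group n) (A_set n) (G_group n) (A_set n) \<phi>"

definition t_bar :: "nat \<Rightarrow> int mat set \<Rightarrow> (nat word set \<Rightarrow> nat word set) set" where
  "t_bar n =
     induced_map (M_units n) (iota_image n) (AutoGroup (G_group n)) (Inn (G_group n)) (t_map n)"

definition pi_bar :: "nat \<Rightarrow> (nat word set \<Rightarrow> nat word set) set \<Rightarrow>
    (nat word set set \<Rightarrow> nat word set set) set" where
  "pi_bar n =
     induced_map (AutoGroup (G_group n)) (Inn (G_group n))
       (AutoGroup (W_group n)) (Inn (W_group n)) (pi_map n)"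

end

theory Submission
  imports Defs
begin

text \<open>
Write \<open>q\<^sub>j = x\<^sub>j\<^sup>2\<close>. The relations say that \<open>x\<^sub>i\<close> inverts \<open>q\<^sub>j\<close> for \<open>i \<noteq> j\<close>, while it centralises
\<open>q\<^sub>i\<close>. So \<open>G\<close> acts on \<open>A\<close> by changing signs of coordinates, and \<open>A\<close> is abelian and normal. Two actions
of \<open>G\<close>, which exist by the universal property of the presentation, show that nothing else
collapses. The homomorphisms to the infinite dihedral group in \<open>coordinate_hom_exists\<close> read off the
exponents, so \<open>A\<close> is free abelian on the \<open>q\<^sub>j\<close>. The action on reduced words in
\<open>reduced_word_action\<close> gives the normal form theorem for \<open>W = G/A\<close>.

Three facts about the free product \<open>W\<close> are then read off from reduced words. Every involution is a conjugate
of a generator, and distinct generators are not conjugate; so an automorphism \<open>\<psi>\<close> of \<open>W\<close> has the form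
\<open>x\<^sub>i \<mapsto> h\<^sub>i x\<^bsub>\<sigma>(i)\<^esub> h\<^sub>i\<^sup>-\<^sup>1\<close> with a permutation \<open>\<sigma>\<close>. For at least three generators the centre is
trivial, and so is every abelian normal subgroup. The last fact makes \<open>A\<close> characteristic: for
\<open>\<phi> \<in> Aut(G)\<close> the image of \<open>\<phi>(A)\<close> in \<open>W\<close> is abelian and normal, so it is trivial. Hence \<open>\<pi>\<close> is defined.

The middle row is the core. The factor \<open>1 + 2 a\<^sub>j\<^sub>j\<close> in the operation of \<open>M\<close> comes from
\<open>t\<^sub>a(q\<^sub>j) = q\<^sub>j\<close> to the power \<open>1 + 2 a\<^sub>j\<^sub>j\<close>. An automorphism that is trivial on \<open>W\<close> moves each \<open>x\<^sub>i\<close> by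
an element of \<open>A\<close>, so it is some \<open>t\<^sub>a\<close>; its inverse is some \<open>t\<^sub>b\<close>, and \<open>a\<close>, \<open>b\<close> are inverse to each other since \<open>t\<close> is
injective. For the surjectivity of \<open>\<pi>\<close>, generators of \<open>Aut(W)\<close> are avoided: if
\<open>g\<^sub>i \<in> G\<close> lifts \<open>h\<^sub>i\<close>, then \<open>x\<^sub>i \<mapsto> g\<^sub>i x\<^bsub>\<sigma>(i)\<^esub> g\<^sub>i\<^sup>-\<^sup>1\<close> respects the relations, because the signs by which \<open>G\<close> acts on \<open>A\<close> are
invariant under conjugation. This endomorphism permutes the \<open>q\<^sub>j\<close> up to sign and induces \<open>\<psi>\<close>, so it is bijective on
\<open>A\<close> and on \<open>W\<close>, hence on \<open>G\<close>.

The columns of \<open>G\<close> and \<open>W\<close> are exact because both groups have trivial centre, and the bottom row follows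
from the other two rows by the nine lemma.
\<close>

section \<open>Presentations\<close>

lemma pres_eq_lists:
  "pres_eq S R u v \<Longrightarrow> u \<in> lists (S \<times> UNIV) \<and> v \<in> lists (S \<times> UNIV)"
  by (induction rule: pres_eq.induct) auto

lemma pres_class_eq_iff:
  assumes "u \<in> lists (S \<times> UNIV)"
  shows "pres_class S R u = pres_class S R v \<longleftrightarrow> pres_eq S R u v"
  using assms unfolding pres_class_def
  by (auto intro: pres_eq.refl pres_eq.sym pres_eq.trans)

lemma presented_group_mult:
  assumes "u \<in> lists (S \<times> UNIV)" "v \<in> lists (S \<times> UNIV)"
  shows "pres_class S R u \<otimes>\<^bsub>presented_group S R\<^esub> pres_class S R v = pres_class S R (u @ v)"
proof -
  have *: "pres_class S R (u' @ v') = pres_class S R (u @ v)"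
    if "u' \<in> pres_class S R u" "v' \<in> pres_class S R v" for u' v'
  proof -
    have "pres_eq S R (u @ v) (u' @ v')"
      using that by (auto simp: pres_class_def intro: pres_eq.append)
    with assms show ?thesis
      using pres_class_eq_iff[of "u @ v" S R "u' @ v'"] by simp
  qed
  have "u \<in> pres_class S R u" "v \<in> pres_class S R v"
    using assms by (simp_all add: pres_class_def pres_eq.refl)
  then have "(\<Union>u'\<in>pres_class S R u. \<Union>v'\<in>pres_class S R v. pres_class S R (u' @ v')) =
      pres_class S R (u @ v)"
    using * by blast
  then show ?thesis
    by (simp add: presented_group_def)
qed

lemma presented_group_one: "\<one>\<^bsub>presented_group S R\<^esub> = pres_class S R []"
  by (simp add: presented_group_def)

lemma presented_group_carrier:
  "carrier (presented_group S R) = pres_class S R ` lists (S \<times> UNIV)"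
  by (simp add: presented_group_def)

lemma pres_class_carrier:
  "u \<in> lists (S \<times> UNIV) \<Longrightarrow> pres_class S R u \<in> carrier (presented_group S R)"
  by (simp add: presented_group_carrier)

lemma pres_eq_inverse_word:
  assumes "u \<in> lists (S \<times> UNIV)"
  shows "pres_eq S R (rev (map (\<lambda>(s, b). (s, \<not> b)) u) @ u) []"
  using assms
proof (induction u)
  case Nil
  then show ?case by (simp add: pres_eq.refl)
next
  case (Cons p u)
  obtain s b where p: "p = (s, b)" by (cases p)
  let ?r = "rev (map (\<lambda>(s, b). (s, \<not> b)) u)"
  have u: "u \<in> lists (S \<times> UNIV)" and s: "s \<in> S"
    using Cons.hyps p by auto
  have r: "?r \<in> lists (S \<times> UNIV)"
    using u by auto
  have "pres_eq S R ([(s, \<not> b), (s, \<not> \<not> b)] @ u) ([] @ u)"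
    by (rule pres_eq.append[OF pres_eq.cancel[OF s] pres_eq.refl[OF u]])
  then have "pres_eq S R (?r @ ([(s, \<not> b), (s, \<not> \<not> b)] @ u)) (?r @ u)"
    by (intro pres_eq.append[OF pres_eq.refl[OF r]]) simp
  then show ?case
    using Cons.IH u p by (auto intro: pres_eq.trans)
qed

lemma presented_group_is_group: "group (presented_group S R)"
proof (rule groupI)
  fix x assume "x \<in> carrier (presented_group S R)"
  then obtain u where u: "u \<in> lists (S \<times> UNIV)" and x: "x = pres_class S R u"
    by (auto simp: presented_group_carrier)
  let ?r = "rev (map (\<lambda>(s, b). (s, \<not> b)) u)"
  have r: "?r \<in> lists (S \<times> UNIV)"
    using u by auto
  have "pres_class S R ?r \<otimes>\<^bsub>presented_group S R\<^esub> x = \<one>\<^bsub>presented_group S R\<^esub>"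
    using u r pres_eq_inverse_word[OF u, of R]
    by (simp add: x presented_group_mult presented_group_one pres_class_eq_iff)
  moreover have "pres_class S R ?r \<in> carrier (presented_group S R)"
    using r by (rule pres_class_carrier)
  ultimately show "\<exists>y\<in>carrier (presented_group S R).
      y \<otimes>\<^bsub>presented_group S R\<^esub> x = \<one>\<^bsub>presented_group S R\<^esub>"
    by blast
next
  show "\<one>\<^bsub>presented_group S R\<^esub> \<in> carrier (presented_group S R)"
    by (simp add: presented_group_carrier presented_group_one)
next
  fix x y assume "x \<in> carrier (presented_group S R)" "y \<in> carrier (presented_group S R)"
  then obtain u v where "u \<in> lists (S \<times> UNIV)" "x = pres_class S R u"
      "v \<in> lists (S \<times> UNIV)" "y = pres_class S R v"
    unfolding presented_group_carrier by blast
  then show "x \<otimes>\<^bsub>presented_group S R\<^esub> y \<in> carrier (presented_group S R)"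
    by (simp add: presented_group_carrier presented_group_mult)
next
  fix x y z assume "x \<in> carrier (presented_group S R)" "y \<in> carrier (presented_group S R)"
    "z \<in> carrier (presented_group S R)"
  then obtain u v w where "u \<in> lists (S \<times> UNIV)" "x = pres_class S R u"
      "v \<in> lists (S \<times> UNIV)" "y = pres_class S R v" "w \<in> lists (S \<times> UNIV)" "z = pres_class S R w"
    unfolding presented_group_carrier by blast
  then show "x \<otimes>\<^bsub>presented_group S R\<^esub> y \<otimes>\<^bsub>presented_group S R\<^esub> z =
      x \<otimes>\<^bsub>presented_group S R\<^esub> (y \<otimes>\<^bsub>presented_group S R\<^esub> z)"
    by (simp add: presented_group_mult)
next
  fix x assume "x \<in> carrier (presented_group S R)"
  then obtain u where "u \<in> lists (S \<times> UNIV)" "x = pres_class S R u"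
    unfolding presented_group_carrier by blast
  then show "\<one>\<^bsub>presented_group S R\<^esub> \<otimes>\<^bsub>presented_group S R\<^esub> x = x"
    by (simp add: presented_group_mult presented_group_one)
qed

lemma pres_gen_inverse:
  assumes "s \<in> S"
  shows "inv\<^bsub>presented_group S R\<^esub> pres_class S R [(s, False)] = pres_class S R [(s, True)]"
proof (rule group.inv_equality[OF presented_group_is_group])
  show "pres_class S R [(s, True)] \<otimes>\<^bsub>presented_group S R\<^esub> pres_class S R [(s, False)] =
      \<one>\<^bsub>presented_group S R\<^esub>"
    using assms pres_eq.cancel[of s S R True]
    by (simp add: presented_group_mult presented_group_one pres_class_eq_iff)
qed (use assms in \<open>simp_all add: pres_class_carrier\<close>)

lemma presented_group_induct [consumes 1, case_names one gen gen_inv]: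
  assumes "g \<in> carrier (presented_group S R)"
    and "P \<one>\<^bsub>presented_group S R\<^esub>"
    and "\<And>s g. s \<in> S \<Longrightarrow> g \<in> carrier (presented_group S R) \<Longrightarrow> P g \<Longrightarrow>
      P (pres_class S R [(s, False)] \<otimes>\<^bsub>presented_group S R\<^esub> g)"
    and "\<And>s g. s \<in> S \<Longrightarrow> g \<in> carrier (presented_group S R) \<Longrightarrow> P g \<Longrightarrow>
      P (inv\<^bsub>presented_group S R\<^esub> pres_class S R [(s, False)] \<otimes>\<^bsub>presented_group S R\<^esub> g)"
  shows "P g"
proof -
  obtain u where u: "u \<in> lists (S \<times> UNIV)" and g: "g = pres_class S R u"
    using assms(1) by (auto simp: presented_group_carrier)
  have "P (pres_class S R u)"
    using u
  proof (induction u)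
    case Nil
    then show ?case using assms(2) by (simp add: presented_group_one)
  next
    case (Cons p u)
    obtain s b where p: "p = (s, b)" by (cases p)
    have s: "s \<in> S" and u: "u \<in> lists (S \<times> UNIV)" and IH: "P (pres_class S R u)"
      using Cons p by auto
    have uc: "pres_class S R u \<in> carrier (presented_group S R)"
      using u by (rule pres_class_carrier)
    have eq: "pres_class S R (p # u) = pres_class S R [(s, b)] \<otimes>\<^bsub>presented_group S R\<^esub> pres_class S R u"
      unfolding p using s u by (subst presented_group_mult) simp_all
    have "P (pres_class S R [(s, b)] \<otimes>\<^bsub>presented_group S R\<^esub> pres_class S R u)"
      using assms(3)[OF s uc IH] assms(4)[OF s uc IH]
      by (induction b) (simp_all add: pres_gen_inverse[OF s])
    then show ?case unfolding eq .
  qed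
  then show ?thesis by (simp add: g)
qed

definition word_eval :: "('g, 'm) monoid_scheme \<Rightarrow> ('s \<Rightarrow> 'g) \<Rightarrow> 's word \<Rightarrow> 'g" where
  "word_eval H f w = foldr (\<lambda>(s, b) x. (if b then inv\<^bsub>H\<^esub> f s else f s) \<otimes>\<^bsub>H\<^esub> x) w \<one>\<^bsub>H\<^esub>"

lemma word_eval_simps [simp]:
  "word_eval H f [] = \<one>\<^bsub>H\<^esub>"
  "word_eval H f ((s, b) # w) = (if b then inv\<^bsub>H\<^esub> f s else f s) \<otimes>\<^bsub>H\<^esub> word_eval H f w"
  by (simp_all add: word_eval_def)

lemma (in group) word_eval_closed:
  assumes "f ` S \<subseteq> carrier G" "w \<in> lists (S \<times> UNIV)"
  shows "word_eval G f w \<in> carrier G"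
  using assms(2)
proof (induction w)
  case (Cons p w)
  then show ?case using assms(1) by (cases p) auto
qed simp

lemma (in group) word_eval_append:
  assumes "f ` S \<subseteq> carrier G" "v \<in> lists (S \<times> UNIV)" "w \<in> lists (S \<times> UNIV)"
  shows "word_eval G f (v @ w) = word_eval G f v \<otimes> word_eval G f w"
  using assms(2)
proof (induction v)
  case Nil
  then show ?case using assms word_eval_closed[OF assms(1,3)] by simp
next
  case (Cons p v)
  obtain s b where p: "p = (s, b)" by (cases p)
  have "f s \<in> carrier G" "word_eval G f v \<in> carrier G" "word_eval G f w \<in> carrier G"
    using Cons.hyps p assms word_eval_closed[OF assms(1)] by auto
  then show ?case using Cons p by (simp add: m_assoc)
qed

lemma word_eval_presented_group:
  assumes "w \<in> lists (S \<times> UNIV)"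
  shows "word_eval (presented_group S R) (\<lambda>s. pres_class S R [(s, False)]) w = pres_class S R w"
  using assms
proof (induction w)
  case Nil
  then show ?case by (simp add: presented_group_one)
next
  case (Cons p w)
  obtain s b where p: "p = (s, b)" by (cases p)
  then have s: "s \<in> S" using Cons.hyps by simp
  have "word_eval (presented_group S R) (\<lambda>s. pres_class S R [(s, False)]) ((s, b) # w) =
      pres_class S R [(s, b)] \<otimes>\<^bsub>presented_group S R\<^esub> pres_class S R w"
    using Cons.IH pres_gen_inverse[OF s] by (cases b) simp_all
  also have "\<dots> = pres_class S R ([(s, b)] @ w)"
    using Cons.hyps s by (intro presented_group_mult) simp_all
  finally show ?case by (simp add: p)
qed

text \<open>The universal property of a presentation: words that are equal in the presented group
  have equal values in every group in which the relations hold.\<close>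

lemma (in group) presented_group_hom_exists:
  assumes f: "f ` S \<subseteq> carrier G"
    and rel: "\<And>u v. (u, v) \<in> R \<Longrightarrow> word_eval G f u = word_eval G f v"
  shows "\<exists>F \<in> hom (presented_group S R) G. \<forall>s\<in>S. F (pres_class S R [(s, False)]) = f s"
proof -
  have eq: "word_eval G f u = word_eval G f v" if "pres_eq S R u v" for u v
    using that
  proof (induction rule: pres_eq.induct)
    case (append u v u' v')
    have "u \<in> lists (S \<times> UNIV)" "v \<in> lists (S \<times> UNIV)"
        "u' \<in> lists (S \<times> UNIV)" "v' \<in> lists (S \<times> UNIV)"
      using pres_eq_lists[OF append.hyps(1)] pres_eq_lists[OF append.hyps(2)] by simp_all
    then show ?case
      by (simp only: word_eval_append[OF f] append.IH)
  next
    case (cancel s b)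
    then have "f s \<in> carrier G" using f by auto
    then show ?case by (cases b) auto
  next
    case (relation u v)
    show ?case using relation(1) by (rule rel)
  qed simp_all
  define F where "F U = word_eval G f (SOME u. u \<in> U)" for U
  have F: "F (pres_class S R u) = word_eval G f u" if "u \<in> lists (S \<times> UNIV)" for u
  proof -
    have "u \<in> pres_class S R u" using that by (auto simp: pres_class_def intro: pres_eq.refl)
    then have "(SOME v. v \<in> pres_class S R u) \<in> pres_class S R u" by (rule someI)
    then have "pres_eq S R u (SOME v. v \<in> pres_class S R u)" by (simp add: pres_class_def)
    from eq[OF this] show ?thesis unfolding F_def by simp
  qed
  show ?thesis
  proof (intro bexI ballI)
    show "F (pres_class S R [(s, False)]) = f s" if "s \<in> S" for s
    proof -
      have "f s \<in> carrier G" using that f by blast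
      then show ?thesis using F[of "[(s, False)]"] that by simp
    qed
    show "F \<in> hom (presented_group S R) G"
    proof (rule homI)
      fix x assume "x \<in> carrier (presented_group S R)"
      then show "F x \<in> carrier G"
        unfolding presented_group_carrier using F word_eval_closed[OF f] by fastforce
    next
      fix x y assume "x \<in> carrier (presented_group S R)" "y \<in> carrier (presented_group S R)"
      then obtain u v where "u \<in> lists (S \<times> UNIV)" "x = pres_class S R u"
          "v \<in> lists (S \<times> UNIV)" "y = pres_class S R v"
        unfolding presented_group_carrier by blast
      then show "F (x \<otimes>\<^bsub>presented_group S R\<^esub> y) = F x \<otimes> F y"
        by (simp add: presented_group_mult F word_eval_append[OF f])
    qed
  qed
qed

section \<open>Automorphism groups, quotients and the nine lemma\<close>

declare mult_FactGroup [simp del] one_FactGroup [simp del]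

lemma carrier_AutoGroup_iff:
  "\<phi> \<in> carrier (AutoGroup G) \<longleftrightarrow>
     \<phi> \<in> hom G G \<and> \<phi> \<in> extensional (carrier G) \<and> bij_betw \<phi> (carrier G) (carrier G)"
  by (auto simp: AutoGroup_def auto_def Bij_def)

lemma AutoGroup_mult:
  "\<phi> \<in> carrier (AutoGroup G) \<Longrightarrow> \<psi> \<in> carrier (AutoGroup G) \<Longrightarrow>
     \<phi> \<otimes>\<^bsub>AutoGroup G\<^esub> \<psi> = compose (carrier G) \<phi> \<psi>"
  by (simp add: AutoGroup_def auto_def BijGroup_def)

lemma AutoGroup_one: "\<one>\<^bsub>AutoGroup G\<^esub> = (\<lambda>x\<in>carrier G. x)"
  by (simp add: AutoGroup_def BijGroup_def)

lemma AutoGroup_group_hom: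
  assumes "group G" "\<phi> \<in> carrier (AutoGroup G)"
  shows "group_hom G G \<phi>"
  using assms by (simp add: group_hom_def group_hom_axioms_def carrier_AutoGroup_iff)

lemma AutoGroup_eqI:
  assumes "\<phi> \<in> carrier (AutoGroup G)" "\<psi> \<in> carrier (AutoGroup G)"
    and "\<And>x. x \<in> carrier G \<Longrightarrow> \<phi> x = \<psi> x"
  shows "\<phi> = \<psi>"
  using assms by (auto simp: carrier_AutoGroup_iff intro: extensionalityI)

context group
begin

lemma conj_aut_carrier:
  assumes g: "g \<in> carrier G"
  shows "conj_aut G g \<in> carrier (AutoGroup G)"
proof -
  have "conj_aut G g \<in> hom G G"
    using g by (auto simp: hom_def conj_aut_def m_assoc inv_solve_left)
  moreover have "g \<otimes> (inv g \<otimes> x) = x" "inv g \<otimes> (g \<otimes> x) = x" if "x \<in> carrier G" for x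
    using g that by (simp_all flip: m_assoc)
  then have "bij_betw (conj_aut G g) (carrier G) (carrier G)"
    using g by (intro bij_betwI[where g = "conj_aut G (inv g)"]) (auto simp: conj_aut_def m_assoc)
  ultimately show ?thesis
    by (simp add: carrier_AutoGroup_iff conj_aut_def)
qed

lemma conj_aut_mult:
  assumes "g \<in> carrier G" "h \<in> carrier G"
  shows "conj_aut G (g \<otimes> h) = conj_aut G g \<otimes>\<^bsub>AutoGroup G\<^esub> conj_aut G h"
  unfolding AutoGroup_mult[OF conj_aut_carrier[OF assms(1)] conj_aut_carrier[OF assms(2)]]
  using assms by (auto simp: compose_def conj_aut_def m_assoc inv_mult_group)

lemma conj_aut_group_hom: "group_hom G (AutoGroup G) (conj_aut G)"
  using AutoGroup group_axioms
  by (simp add: group_hom_def group_hom_axioms_def hom_def conj_aut_carrier conj_aut_mult)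

lemma AutoGroup_conj_aut:
  assumes \<phi>: "\<phi> \<in> carrier (AutoGroup G)" and g: "g \<in> carrier G"
  shows "\<phi> \<otimes>\<^bsub>AutoGroup G\<^esub> conj_aut G g \<otimes>\<^bsub>AutoGroup G\<^esub> inv\<^bsub>AutoGroup G\<^esub> \<phi> = conj_aut G (\<phi> g)"
proof -
  interpret Aut: group "AutoGroup G" by (rule AutoGroup)
  interpret \<phi>: group_hom G G \<phi> by (rule AutoGroup_group_hom[OF group_axioms \<phi>])
  have "\<phi> \<otimes>\<^bsub>AutoGroup G\<^esub> conj_aut G g = conj_aut G (\<phi> g) \<otimes>\<^bsub>AutoGroup G\<^esub> \<phi>"
    unfolding AutoGroup_mult[OF \<phi> conj_aut_carrier[OF g]]
      AutoGroup_mult[OF conj_aut_carrier[OF \<phi>.hom_closed[OF g]] \<phi>]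
    using g by (auto simp: compose_def conj_aut_def)
  then show ?thesis
    using \<phi> g by (simp add: conj_aut_carrier Aut.m_assoc)
qed

lemma Inn_normal: "Inn G \<lhd> AutoGroup G"
proof -
  interpret Aut: group "AutoGroup G" by (rule AutoGroup)
  interpret c: group_hom G "AutoGroup G" "conj_aut G" by (rule conj_aut_group_hom)
  show ?thesis
    unfolding Aut.normal_inv_iff
  proof (intro conjI ballI)
    show "subgroup (Inn G) (AutoGroup G)"
      unfolding Inn_def by (rule c.img_is_subgroup)
    fix \<phi> \<theta> assume \<phi>: "\<phi> \<in> carrier (AutoGroup G)" and "\<theta> \<in> Inn G"
    then obtain g where "g \<in> carrier G" "\<theta> = conj_aut G g"
      by (auto simp: Inn_def)
    with \<phi> show "\<phi> \<otimes>\<^bsub>AutoGroup G\<^esub> \<theta> \<otimes>\<^bsub>AutoGroup G\<^esub> inv\<^bsub>AutoGroup G\<^esub> \<phi> \<in> Inn G"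
      using group_hom.hom_closed[OF AutoGroup_group_hom[OF group_axioms \<phi>]]
      by (simp add: AutoGroup_conj_aut Inn_def)
  qed
qed

end

lemma quot_map_group_hom:
  assumes "N \<lhd> G"
  shows "group_hom G (G Mod N) (quot_map G N)"
proof -
  interpret normal N G by (rule assms)
  show ?thesis
    using factorgroup_is_group is_group r_coset_hom_Mod
    by (simp add: group_hom_def group_hom_axioms_def quot_map_def[abs_def])
qed

lemma quot_map_eq_iff:
  assumes "N \<lhd> G" "x \<in> carrier G" "y \<in> carrier G"
  shows "quot_map G N x = quot_map G N y \<longleftrightarrow> x \<otimes>\<^bsub>G\<^esub> inv\<^bsub>G\<^esub> y \<in> N"
proof -
  interpret normal N G by (rule assms)
  show ?thesis
    using assms rcos_module[OF is_group, of y x] repr_independence[of x N y]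
      rcos_self[of x N] subgroup_axioms
    by (auto simp: quot_map_def)
qed

lemma quot_map_eq_one_iff:
  assumes "N \<lhd> G" "x \<in> carrier G"
  shows "quot_map G N x = \<one>\<^bsub>G Mod N\<^esub> \<longleftrightarrow> x \<in> N"
proof -
  interpret normal N G by (rule assms)
  show ?thesis
    using assms coset_join1[of N x] coset_join2[of x N] subgroup_axioms subset
    by (auto simp: quot_map_def one_FactGroup)
qed

lemma carrier_quotient: "carrier (G Mod N) = quot_map G N ` carrier G"
  by (simp add: carrier_FactGroup quot_map_def[abs_def])

lemma short_exact_quotient:
  assumes N: "N \<lhd> G" and f: "group_hom K G f" "inj_on f (carrier K)" "f ` carrier K = N"
  shows "group_short_exact K f G (quot_map G N) (G Mod N)"
proof -
  interpret group_hom K G f by (rule f(1))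
  have "N \<subseteq> carrier G"
    using N by (simp add: normal_imp_subgroup subgroup.subset)
  moreover have "kernel K G f = {\<one>\<^bsub>K\<^esub>}"
    using f(2) by (simp add: inj_iff_trivial_ker)
  ultimately show ?thesis
    using f quot_map_group_hom[OF N] quot_map_eq_one_iff[OF N]
    by (auto simp: group_short_exact_def kernel_def[of G] carrier_quotient)
qed

text \<open>Injectivity of \<open>G \<rightarrow> Aut(G)\<close> means that the centre of \<open>G\<close> is trivial; the rest holds for every group.\<close>

lemma (in group) short_exact_conj_aut:
  assumes "\<And>z. z \<in> carrier G \<Longrightarrow> \<forall>h\<in>carrier G. z \<otimes> h = h \<otimes> z \<Longrightarrow> z = \<one>"
  shows "group_short_exact G (conj_aut G) (AutoGroup G) (quot_map (AutoGroup G) (Inn G)) (OutGroup G)"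
  unfolding OutGroup_def
proof (rule short_exact_quotient[OF Inn_normal conj_aut_group_hom])
  interpret c: group_hom G "AutoGroup G" "conj_aut G" by (rule conj_aut_group_hom)
  show "inj_on (conj_aut G) (carrier G)"
    unfolding c.inj_on_one_iff
  proof (intro ballI impI allI)
    fix z assume z: "z \<in> carrier G" and "conj_aut G z = \<one>\<^bsub>AutoGroup G\<^esub>"
    then have 1: "conj_aut G z = (\<lambda>x\<in>carrier G. x)"
      by (simp only: AutoGroup_one)
    have "z \<otimes> h = h \<otimes> z" if h: "h \<in> carrier G" for h
    proof -
      have "z \<otimes> h \<otimes> inv z = h"
        using fun_cong[OF 1, of h] h by (simp add: conj_aut_def)
      then show ?thesis using z h by (metis inv_solve_right m_closed)
    qed
    then have "\<forall>h\<in>carrier G. z \<otimes> h = h \<otimes> z" by blast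
    with z show "z = \<one>" by (rule assms)
  qed
qed (simp add: Inn_def)

text \<open>The value does not depend on the representative, since \<open>f\<close> maps \<open>N\<close> into \<open>K\<close>.\<close>

lemma induced_map_quot:
  assumes N: "N \<lhd> G" and K: "K \<lhd> H" and f: "group_hom G H f" and fN: "f ` N \<subseteq> K"
    and g: "g \<in> carrier G"
  shows "induced_map G N H K f (quot_map G N g) = quot_map H K (f g)"
proof -
  interpret f: group_hom G H f by (rule f)
  have NG: "N \<subseteq> carrier G"
    using N by (simp add: normal_imp_subgroup subgroup.subset)
  have "quot_map H K (f y) = quot_map H K (f g)" if y: "y \<in> N #>\<^bsub>G\<^esub> g" for y
  proof -
    obtain m where m: "m \<in> N" "y = m \<otimes>\<^bsub>G\<^esub> g"
      using y by (auto simp: r_coset_def)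
    then have "f y \<otimes>\<^bsub>H\<^esub> inv\<^bsub>H\<^esub> f g = f m" "y \<in> carrier G"
      using g NG by (auto simp: f.H.m_assoc)
    then show ?thesis
      using m(1) g fN by (subst quot_map_eq_iff[OF K]) auto
  qed
  moreover have "g \<in> N #>\<^bsub>G\<^esub> g"
    using f.G.rcos_self[OF g] N by (simp add: normal_imp_subgroup)
  ultimately have "(\<lambda>x. quot_map H K (f x)) ` (N #>\<^bsub>G\<^esub> g) = {quot_map H K (f g)}"
    by blast
  then show ?thesis
    using g by (simp add: induced_map_def carrier_quotient quot_map_def[of G])
qed

lemma induced_map_group_hom:
  assumes N: "N \<lhd> G" and K: "K \<lhd> H" and f: "group_hom G H f" and fN: "f ` N \<subseteq> K"
  shows "group_hom (G Mod N) (H Mod K) (induced_map G N H K f)"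
proof -
  interpret f: group_hom G H f by (rule f)
  interpret p: group_hom G "G Mod N" "quot_map G N" by (rule quot_map_group_hom[OF N])
  interpret q: group_hom H "H Mod K" "quot_map H K" by (rule quot_map_group_hom[OF K])
  have "induced_map G N H K f \<in> hom (G Mod N) (H Mod K)"
  proof (rule homI)
    fix x assume "x \<in> carrier (G Mod N)"
    then show "induced_map G N H K f x \<in> carrier (H Mod K)"
      by (auto simp: carrier_quotient induced_map_quot[OF N K f fN])
  next
    fix x y assume "x \<in> carrier (G Mod N)" "y \<in> carrier (G Mod N)"
    then obtain a b where ab: "a \<in> carrier G" "b \<in> carrier G"
        "x = quot_map G N a" "y = quot_map G N b"
      by (auto simp: carrier_quotient)
    have "induced_map G N H K f (x \<otimes>\<^bsub>G Mod N\<^esub> y) = induced_map G N H K f (quot_map G N (a \<otimes>\<^bsub>G\<^esub> b))"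
      unfolding ab(3,4) p.hom_mult[OF ab(1,2)] ..
    also have "\<dots> = quot_map H K (f a \<otimes>\<^bsub>H\<^esub> f b)"
      using ab(1,2) induced_map_quot[OF N K f fN, of "a \<otimes>\<^bsub>G\<^esub> b"] by simp
    also have "\<dots> = quot_map H K (f a) \<otimes>\<^bsub>H Mod K\<^esub> quot_map H K (f b)"
      using ab(1,2) by (intro q.hom_mult f.hom_closed)
    finally show "induced_map G N H K f (x \<otimes>\<^bsub>G Mod N\<^esub> y) =
        induced_map G N H K f x \<otimes>\<^bsub>H Mod K\<^esub> induced_map G N H K f y"
      using ab induced_map_quot[OF N K f fN] by simp
  qed
  then show ?thesis
    by (simp add: group_hom_def group_hom_axioms_def p.H.group_axioms q.H.group_axioms)
qed

text \<open>A diagram chase. The injectivity of \<open>\<gamma>\<close> is what makes the first map of the bottom row injective: if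
  \<open>f\<^sub>2 k = \<beta> h\<close>, then \<open>\<gamma> (g\<^sub>1 h) = 1\<close>, so that \<open>h\<close> comes from \<open>K\<^sub>1\<close>.\<close>

lemma nine_lemma:
  assumes row1: "group_short_exact K\<^sub>1 f\<^sub>1 H\<^sub>1 g\<^sub>1 Q\<^sub>1" and row2: "group_short_exact K\<^sub>2 f\<^sub>2 H\<^sub>2 g\<^sub>2 Q\<^sub>2"
    and \<alpha>: "group_hom K\<^sub>1 K\<^sub>2 \<alpha>" "\<alpha> ` carrier K\<^sub>1 \<lhd> K\<^sub>2"
    and \<beta>: "group_hom H\<^sub>1 H\<^sub>2 \<beta>" "\<beta> ` carrier H\<^sub>1 \<lhd> H\<^sub>2"
    and \<gamma>: "group_hom Q\<^sub>1 Q\<^sub>2 \<gamma>" "\<gamma> ` carrier Q\<^sub>1 \<lhd> Q\<^sub>2" "inj_on \<gamma> (carrier Q\<^sub>1)"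
    and left: "\<And>k. k \<in> carrier K\<^sub>1 \<Longrightarrow> f\<^sub>2 (\<alpha> k) = \<beta> (f\<^sub>1 k)"
    and right: "\<And>h. h \<in> carrier H\<^sub>1 \<Longrightarrow> g\<^sub>2 (\<beta> h) = \<gamma> (g\<^sub>1 h)"
  shows "group_short_exact
    (K\<^sub>2 Mod \<alpha> ` carrier K\<^sub>1)
    (induced_map K\<^sub>2 (\<alpha> ` carrier K\<^sub>1) H\<^sub>2 (\<beta> ` carrier H\<^sub>1) f\<^sub>2)
    (H\<^sub>2 Mod \<beta> ` carrier H\<^sub>1)
    (induced_map H\<^sub>2 (\<beta> ` carrier H\<^sub>1) Q\<^sub>2 (\<gamma> ` carrier Q\<^sub>1) g\<^sub>2)
    (Q\<^sub>2 Mod \<gamma> ` carrier Q\<^sub>1)"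
proof -
  interpret f1: group_hom K\<^sub>1 H\<^sub>1 f\<^sub>1 using row1 by (simp add: group_short_exact_def)
  interpret g1: group_hom H\<^sub>1 Q\<^sub>1 g\<^sub>1 using row1 by (simp add: group_short_exact_def)
  interpret f2: group_hom K\<^sub>2 H\<^sub>2 f\<^sub>2 using row2 by (simp add: group_short_exact_def)
  interpret g2: group_hom H\<^sub>2 Q\<^sub>2 g\<^sub>2 using row2 by (simp add: group_short_exact_def)
  interpret a: group_hom K\<^sub>1 K\<^sub>2 \<alpha> by (rule \<alpha>(1))
  interpret b: group_hom H\<^sub>1 H\<^sub>2 \<beta> by (rule \<beta>(1))
  interpret c: group_hom Q\<^sub>1 Q\<^sub>2 \<gamma> by (rule \<gamma>(1))
  have k1: "h \<in> f\<^sub>1 ` carrier K\<^sub>1" if "h \<in> carrier H\<^sub>1" "g\<^sub>1 h = \<one>\<^bsub>Q\<^sub>1\<^esub>" for h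
    using row1 that by (simp add: group_short_exact_def kernel_def)
  have k2: "h \<in> f\<^sub>2 ` carrier K\<^sub>2" if "h \<in> carrier H\<^sub>2" "g\<^sub>2 h = \<one>\<^bsub>Q\<^sub>2\<^esub>" for h
    using row2 that by (simp add: group_short_exact_def kernel_def)
  have gf2: "g\<^sub>2 (f\<^sub>2 k) = \<one>\<^bsub>Q\<^sub>2\<^esub>" if "k \<in> carrier K\<^sub>2" for k
    using row2 that by (auto simp: group_short_exact_def kernel_def)
  have inj2: "inj_on f\<^sub>2 (carrier K\<^sub>2)"
    using row2 by (simp add: group_short_exact_def f2.inj_iff_trivial_ker)
  have surj1: "g\<^sub>1 ` carrier H\<^sub>1 = carrier Q\<^sub>1" and surj2: "g\<^sub>2 ` carrier H\<^sub>2 = carrier Q\<^sub>2"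
    using row1 row2 by (auto simp: group_short_exact_def)
  have fa: "f\<^sub>2 ` \<alpha> ` carrier K\<^sub>1 \<subseteq> \<beta> ` carrier H\<^sub>1"
    using left by auto
  have gb: "g\<^sub>2 ` \<beta> ` carrier H\<^sub>1 \<subseteq> \<gamma> ` carrier Q\<^sub>1"
    using right by auto
  let ?f = "induced_map K\<^sub>2 (\<alpha> ` carrier K\<^sub>1) H\<^sub>2 (\<beta> ` carrier H\<^sub>1) f\<^sub>2"
  let ?g = "induced_map H\<^sub>2 (\<beta> ` carrier H\<^sub>1) Q\<^sub>2 (\<gamma> ` carrier Q\<^sub>1) g\<^sub>2"
  let ?p = "quot_map K\<^sub>2 (\<alpha> ` carrier K\<^sub>1)"
  let ?q = "quot_map H\<^sub>2 (\<beta> ` carrier H\<^sub>1)"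
  let ?r = "quot_map Q\<^sub>2 (\<gamma> ` carrier Q\<^sub>1)"
  note f_eq = induced_map_quot[OF \<alpha>(2) \<beta>(2) f2.group_hom_axioms fa]
  note g_eq = induced_map_quot[OF \<beta>(2) \<gamma>(2) g2.group_hom_axioms gb]
  interpret f: group_hom "K\<^sub>2 Mod \<alpha> ` carrier K\<^sub>1" "H\<^sub>2 Mod \<beta> ` carrier H\<^sub>1" ?f
    by (rule induced_map_group_hom[OF \<alpha>(2) \<beta>(2) f2.group_hom_axioms fa])
  interpret g: group_hom "H\<^sub>2 Mod \<beta> ` carrier H\<^sub>1" "Q\<^sub>2 Mod \<gamma> ` carrier Q\<^sub>1" ?g
    by (rule induced_map_group_hom[OF \<beta>(2) \<gamma>(2) g2.group_hom_axioms gb])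
  have ker_f: "inj_on ?f (carrier (K\<^sub>2 Mod \<alpha> ` carrier K\<^sub>1))"
    unfolding f.inj_on_one_iff
  proof (intro ballI impI allI)
    fix C assume "C \<in> carrier (K\<^sub>2 Mod \<alpha> ` carrier K\<^sub>1)" and C: "?f C = \<one>\<^bsub>H\<^sub>2 Mod \<beta> ` carrier H\<^sub>1\<^esub>"
    then obtain k where k: "k \<in> carrier K\<^sub>2" "C = ?p k" by (auto simp: carrier_quotient)
    with C have "f\<^sub>2 k \<in> \<beta> ` carrier H\<^sub>1"
      using f_eq quot_map_eq_one_iff[OF \<beta>(2)] by simp
    then obtain h where h: "h \<in> carrier H\<^sub>1" "f\<^sub>2 k = \<beta> h" by auto
    then have "\<gamma> (g\<^sub>1 h) = \<one>\<^bsub>Q\<^sub>2\<^esub>" using gf2[OF k(1)] right by simp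
    then have "g\<^sub>1 h = \<one>\<^bsub>Q\<^sub>1\<^esub>" using \<gamma>(3) h(1) by (simp add: c.inj_on_one_iff)
    then obtain l where l: "l \<in> carrier K\<^sub>1" "h = f\<^sub>1 l" using k1 h(1) by auto
    then have "f\<^sub>2 k = f\<^sub>2 (\<alpha> l)" using h left by simp
    then have "k = \<alpha> l" using inj2 k(1) l(1) by (auto dest: inj_onD)
    then show "C = \<one>\<^bsub>K\<^sub>2 Mod \<alpha> ` carrier K\<^sub>1\<^esub>"
      using k l(1) quot_map_eq_one_iff[OF \<alpha>(2)] by simp
  qed
  have "?f ` carrier (K\<^sub>2 Mod \<alpha> ` carrier K\<^sub>1) \<subseteq> kernel (H\<^sub>2 Mod \<beta> ` carrier H\<^sub>1) (Q\<^sub>2 Mod \<gamma> ` carrier Q\<^sub>1) ?g"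
  proof (rule image_subsetI)
    fix C assume C: "C \<in> carrier (K\<^sub>2 Mod \<alpha> ` carrier K\<^sub>1)"
    then obtain k where k: "k \<in> carrier K\<^sub>2" "C = ?p k" by (auto simp: carrier_quotient)
    then have "?g (?f C) = ?r \<one>\<^bsub>Q\<^sub>2\<^esub>" using f_eq g_eq gf2 by simp
    also have "\<dots> = \<one>\<^bsub>Q\<^sub>2 Mod \<gamma> ` carrier Q\<^sub>1\<^esub>"
      using group_hom.hom_one[OF quot_map_group_hom[OF \<gamma>(2)]] .
    finally show "?f C \<in> kernel (H\<^sub>2 Mod \<beta> ` carrier H\<^sub>1) (Q\<^sub>2 Mod \<gamma> ` carrier Q\<^sub>1) ?g"
      using f.hom_closed[OF C] by (simp add: kernel_def)
  qed
  moreover have "C \<in> ?f ` carrier (K\<^sub>2 Mod \<alpha> ` carrier K\<^sub>1)"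
    if C: "C \<in> kernel (H\<^sub>2 Mod \<beta> ` carrier H\<^sub>1) (Q\<^sub>2 Mod \<gamma> ` carrier Q\<^sub>1) ?g" for C
  proof -
    obtain h2 where h2: "h2 \<in> carrier H\<^sub>2" "C = ?q h2"
      using C by (auto simp: kernel_def carrier_quotient)
    then have "g\<^sub>2 h2 \<in> \<gamma> ` carrier Q\<^sub>1"
      using C g_eq quot_map_eq_one_iff[OF \<gamma>(2)] by (simp add: kernel_def)
    then obtain h where h: "h \<in> carrier H\<^sub>1" "g\<^sub>2 h2 = g\<^sub>2 (\<beta> h)"
      unfolding surj1[symmetric] using right by auto
    \<comment> \<open>Correcting \<open>h2\<close> by \<open>\<beta> h\<close> on the left does not change its coset.\<close>
    then have "g\<^sub>2 (inv\<^bsub>H\<^sub>2\<^esub> \<beta> h \<otimes>\<^bsub>H\<^sub>2\<^esub> h2) = \<one>\<^bsub>Q\<^sub>2\<^esub>"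
      using h2(1) by simp
    then have "inv\<^bsub>H\<^sub>2\<^esub> \<beta> h \<otimes>\<^bsub>H\<^sub>2\<^esub> h2 \<in> f\<^sub>2 ` carrier K\<^sub>2"
      using k2 h(1) h2(1) by simp
    then obtain k where k: "k \<in> carrier K\<^sub>2" "inv\<^bsub>H\<^sub>2\<^esub> \<beta> h \<otimes>\<^bsub>H\<^sub>2\<^esub> h2 = f\<^sub>2 k"
      by auto
    then have "h2 = \<beta> h \<otimes>\<^bsub>H\<^sub>2\<^esub> f\<^sub>2 k"
      using h(1) h2(1) by (simp flip: k(2) f2.H.m_assoc)
    then have "h2 \<otimes>\<^bsub>H\<^sub>2\<^esub> inv\<^bsub>H\<^sub>2\<^esub> f\<^sub>2 k = \<beta> h"
      using h(1) k(1) by (simp add: f2.H.m_assoc)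
    then have "C = ?q (f\<^sub>2 k)"
      using h2 h(1) k(1) quot_map_eq_iff[OF \<beta>(2)] by simp
    then show ?thesis
      using k(1) f_eq by (auto simp: carrier_quotient)
  qed
  ultimately have mid: "?f ` carrier (K\<^sub>2 Mod \<alpha> ` carrier K\<^sub>1) =
      kernel (H\<^sub>2 Mod \<beta> ` carrier H\<^sub>1) (Q\<^sub>2 Mod \<gamma> ` carrier Q\<^sub>1) ?g"
    by blast
  have "?g ` carrier (H\<^sub>2 Mod \<beta> ` carrier H\<^sub>1) = carrier (Q\<^sub>2 Mod \<gamma> ` carrier Q\<^sub>1)"
    unfolding carrier_quotient image_image surj2[symmetric] using g_eq by (intro image_cong) auto
  moreover have "kernel (K\<^sub>2 Mod \<alpha> ` carrier K\<^sub>1) (H\<^sub>2 Mod \<beta> ` carrier H\<^sub>1) ?f =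
      {\<one>\<^bsub>K\<^sub>2 Mod \<alpha> ` carrier K\<^sub>1\<^esub>}"
    using ker_f unfolding f.inj_iff_trivial_ker .
  ultimately show ?thesis
    unfolding group_short_exact_def
    by (intro conjI f.group_hom_axioms g.group_hom_axioms mid)
qed

section \<open>Free products of groups of order two\<close>

text \<open>The last assumption is the normal form theorem for free products, in the case of
  factors of order two.\<close>

locale free_product_of_involutions = group G for G (structure) +
  fixes I :: "'i set" and s :: "'i \<Rightarrow> 'a"
  assumes s_closed [simp]: "i \<in> I \<Longrightarrow> s i \<in> carrier G"
    and s_square: "i \<in> I \<Longrightarrow> s i \<otimes> s i = \<one>"
    and s_generate: "carrier G \<subseteq> (\<lambda>w. foldr (\<lambda>i. (\<otimes>) (s i)) w \<one>) ` lists I"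
    and reduced_nontrivial:
      "w \<in> lists I \<Longrightarrow> distinct_adj w \<Longrightarrow> w \<noteq> [] \<Longrightarrow> foldr (\<lambda>i. (\<otimes>) (s i)) w \<one> \<noteq> \<one>"
begin

definition val :: "'i list \<Rightarrow> 'a" where
  "val w = foldr (\<lambda>i. (\<otimes>) (s i)) w \<one>"

lemma val_Nil [simp]: "val [] = \<one>"
  and val_Cons [simp]: "val (i # w) = s i \<otimes> val w"
  by (simp_all add: val_def)

lemma val_closed [simp]: "w \<in> lists I \<Longrightarrow> val w \<in> carrier G"
  by (induction w) auto

lemma val_append: "v \<in> lists I \<Longrightarrow> w \<in> lists I \<Longrightarrow> val (v @ w) = val v \<otimes> val w"
  by (induction v) (auto simp: m_assoc)

lemma s_inv: "i \<in> I \<Longrightarrow> inv (s i) = s i"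
  using s_square by (intro inv_equality) auto

lemma rev_lists [simp]: "rev w \<in> lists I \<longleftrightarrow> w \<in> lists I"
  by (simp add: in_lists_conv_set)

lemma val_rev: "w \<in> lists I \<Longrightarrow> val (rev w) = inv (val w)"
  by (induction w) (simp_all add: val_append inv_mult_group s_inv)

lemma reduced_word_exists:
  assumes "g \<in> carrier G"
  obtains w where "w \<in> lists I" "distinct_adj w" "g = val w"
proof -
  have "\<exists>v \<in> lists I. distinct_adj v \<and> val w = val v" if "w \<in> lists I" for w
    using that
  proof (induction w)
    case (Cons i w)
    then obtain v where v: "v \<in> lists I" "distinct_adj v" "val w = val v" by blast
    show ?case
    proof (cases "v \<noteq> [] \<and> hd v = i")
      case True
      then obtain u where u: "v = i # u" by (cases v) auto
      then have "val (i # w) = (s i \<otimes> s i) \<otimes> val u"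
        using v Cons.hyps by (simp add: m_assoc)
      then show ?thesis
        using u v Cons.hyps s_square by (auto dest: distinct_adj_ConsD)
    next
      case False
      then show ?thesis
        using v Cons.hyps by (intro bexI[of _ "i # v"]) (auto simp: distinct_adj_Cons)
    qed
  qed (auto intro: bexI[of _ "[]"])
  moreover obtain w where "w \<in> lists I" "g = val w"
    using assms s_generate by (auto simp: val_def)
  ultimately show ?thesis using that by blast
qed

lemma nontrivial_val: "w \<in> lists I \<Longrightarrow> distinct_adj w \<Longrightarrow> w \<noteq> [] \<Longrightarrow> val w \<noteq> \<one>"
  using reduced_nontrivial by (simp add: val_def)

lemma s_nontrivial: "i \<in> I \<Longrightarrow> s i \<noteq> \<one>"
  using nontrivial_val[of "[i]"] by simp

text \<open>A reduced word whose first and last letter differ has a reduced square, so it has infinite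
  order. Otherwise it is a conjugate of a shorter word.\<close>

lemma involution_conjugate_generator:
  assumes "g \<in> carrier G" "g \<otimes> g = \<one>" "g \<noteq> \<one>"
  shows "\<exists>h \<in> carrier G. \<exists>i \<in> I. g = h \<otimes> s i \<otimes> inv h"
proof -
  have *: "\<exists>h \<in> carrier G. \<exists>i \<in> I. val w = h \<otimes> s i \<otimes> inv h"
    if "w \<in> lists I" "distinct_adj w" "w \<noteq> []" "val w \<otimes> val w = \<one>" for w
    using that
  proof (induction w rule: length_induct)
    case (1 w)
    obtain a v where w: "w = a # v" using 1(4) by (cases w) auto
    show ?case
    proof (cases "v = []")
      case True
      then have "a \<in> I" "val w = \<one> \<otimes> s a \<otimes> inv \<one>" using w 1(2) by simp_all
      then show ?thesis by blast
    next
      case False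
      then obtain u b where v: "v = u @ [b]" by (metis append_butlast_last_id)
      have ab: "a \<in> I" "b \<in> I" "u \<in> lists I" using w v 1 by auto
      have "a = b"
      proof (rule ccontr)
        assume "a \<noteq> b"
        moreover have "hd w = a" "last w = b" using w v by simp_all
        ultimately have "distinct_adj (w @ w)"
          using 1(3) by (simp add: distinct_adj_append_iff)
        then have "val (w @ w) \<noteq> \<one>"
          using nontrivial_val[of "w @ w"] 1(2,4) by simp
        then show False using 1(2,5) by (simp add: val_append)
      qed
      have vw: "val w = s a \<otimes> val u \<otimes> s a"
        using ab w v \<open>a = b\<close> by (simp add: val_append m_assoc)
      have u: "val u = s a \<otimes> val w \<otimes> s a"
      proof -
        have "s a \<otimes> (s a \<otimes> val u) = val u"
          using ab s_square[of a] by (simp flip: m_assoc)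
        then show ?thesis
          using ab s_square[of a] by (simp add: vw m_assoc)
      qed
      have "val u \<otimes> val u = s a \<otimes> val w \<otimes> (s a \<otimes> s a) \<otimes> val w \<otimes> s a"
        using ab 1(2) by (simp add: u m_assoc)
      also have "\<dots> = s a \<otimes> (val w \<otimes> val w) \<otimes> s a"
        using ab 1(2) s_square[of a] by (simp add: m_assoc)
      finally have "val u \<otimes> val u = \<one>"
        using ab 1(5) s_square[of a] by simp
      moreover have "u \<noteq> []"
        using 1(3) w v \<open>a = b\<close> by auto
      moreover have "distinct_adj u"
        using 1(3) w v by (auto dest: distinct_adj_ConsD)
      ultimately have "\<exists>h \<in> carrier G. \<exists>i \<in> I. val u = h \<otimes> s i \<otimes> inv h"
        using ab(3) by (intro 1(1)[rule_format]) (simp_all add: w v)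
      then obtain h i where hi: "h \<in> carrier G" "i \<in> I" "val u = h \<otimes> s i \<otimes> inv h"
        by blast
      then have "val w = (s a \<otimes> h) \<otimes> s i \<otimes> inv (s a \<otimes> h)"
        using ab by (simp add: vw inv_mult_group s_inv m_assoc)
      with hi(1,2) ab(1) show ?thesis
        by (intro bexI[of _ "s a \<otimes> h"] bexI[of _ i]) simp_all
    qed
  qed
  obtain w where w: "w \<in> lists I" "distinct_adj w" "g = val w"
    using assms(1) by (rule reduced_word_exists)
  moreover have "w \<noteq> []" using w(3) assms(3) by auto
  ultimately show ?thesis using *[of w] assms(2) by simp
qed

text \<open>If \<open>s\<^sub>k = w s\<^sub>j w\<^sup>-\<^sup>1\<close> with \<open>j \<noteq> k\<close>, then stripping a last letter \<open>j\<close> or a first letter \<open>k\<close> from \<open>w\<close> leaves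
  a word for which \<open>w s\<^sub>j w\<^sup>-\<^sup>1 s\<^sub>k\<close> is reduced, hence nontrivial.\<close>

lemma conjugate_generators_eq:
  assumes "j \<in> I" "k \<in> I" "h \<in> carrier G" "s k = h \<otimes> s j \<otimes> inv h"
  shows "j = k"
proof -
  have "j = k" if "w \<in> lists I" "distinct_adj w" "s k = val w \<otimes> s j \<otimes> inv (val w)" for w
    using that
  proof (induction w rule: length_induct)
    case (1 w)
    note jk = assms(1,2)
    have triv: "val (w @ j # rev w @ [k]) = \<one>"
      using 1(2,4) jk s_square[of k] by (simp add: val_append val_rev m_assoc)
    consider "w = []" | "w \<noteq> []" "last w = j" | "w \<noteq> []" "hd w = k"
      | "w \<noteq> []" "last w \<noteq> j" "hd w \<noteq> k" by blast
    then show ?case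
    proof cases
      case 1
      with triv jk show ?thesis
        using nontrivial_val[of "[j, k]"] by auto
    next
      case 2
      then obtain v where v: "w = v @ [j]" by (metis append_butlast_last_id)
      with 1(2) have vI: "v \<in> lists I" by simp
      have "val w \<otimes> s j \<otimes> inv (val w) = val v \<otimes> (s j \<otimes> (s j \<otimes> s j)) \<otimes> inv (val v)"
        using vI jk by (simp add: v val_append inv_mult_group s_inv m_assoc)
      with 1(4) have "s k = val v \<otimes> (s j \<otimes> (s j \<otimes> s j)) \<otimes> inv (val v)"
        by (rule HOL.trans)
      then have "s k = val v \<otimes> s j \<otimes> inv (val v)"
        using s_square[of j] jk by simp
      with 1(1,3) v vI show ?thesis by (auto simp: distinct_adj_append_iff)
    next
      case 3
      then obtain v where v: "w = k # v" by (cases w) auto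
      with 1(2) have vI: "v \<in> lists I" by simp
      have "s k \<otimes> s k \<otimes> s k = s k \<otimes> (val w \<otimes> s j \<otimes> inv (val w)) \<otimes> s k"
        by (simp only: 1(4)[symmetric])
      also have "\<dots> = (s k \<otimes> s k) \<otimes> val v \<otimes> s j \<otimes> inv (val v) \<otimes> (s k \<otimes> s k)"
        using vI jk by (simp add: v inv_mult_group s_inv m_assoc)
      finally have "s k = val v \<otimes> s j \<otimes> inv (val v)"
        using s_square[of k] jk vI by simp
      with 1(1,3) v vI show ?thesis by (auto dest: distinct_adj_ConsD)
    next
      case 4
      then have "distinct_adj (w @ j # rev w @ [k])"
        using 1(3) by (auto simp: distinct_adj_append_iff distinct_adj_Cons hd_append hd_rev last_rev)
      then show ?thesis
        using triv nontrivial_val[of "w @ j # rev w @ [k]"] 1(2) jk by simp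
    qed
  qed
  moreover obtain w where "w \<in> lists I" "distinct_adj w" "h = val w"
    using assms(3) by (rule reduced_word_exists)
  ultimately show ?thesis using assms(4) by blast
qed

text \<open>Hence an automorphism permutes the conjugacy classes of the generators: the inverse
  automorphism induces the inverse permutation.\<close>

lemma automorphism_permutes_generators:
  assumes \<psi>: "\<psi> \<in> carrier (AutoGroup G)" and fin: "finite I"
  obtains \<sigma> h where "bij_betw \<sigma> I I" "\<And>i. i \<in> I \<Longrightarrow> h i \<in> carrier G"
    "\<And>i. i \<in> I \<Longrightarrow> \<psi> (s i) = h i \<otimes> s (\<sigma> i) \<otimes> inv (h i)"
proof -
  have *: "\<exists>h \<in> carrier G. \<exists>j \<in> I. \<theta> (s i) = h \<otimes> s j \<otimes> inv h"
    if \<theta>: "\<theta> \<in> carrier (AutoGroup G)" and i: "i \<in> I" for \<theta> i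
  proof (rule involution_conjugate_generator)
    interpret \<theta>: group_hom G G \<theta> by (rule AutoGroup_group_hom[OF group_axioms \<theta>])
    show "\<theta> (s i) \<in> carrier G" using i by simp
    show "\<theta> (s i) \<otimes> \<theta> (s i) = \<one>" using i s_square[OF i] by (simp flip: \<theta>.hom_mult)
    show "\<theta> (s i) \<noteq> \<one>"
      using \<theta> i s_nontrivial[OF i] inj_onD[of \<theta> "carrier G" "s i" \<one>]
      by (auto simp: carrier_AutoGroup_iff bij_betw_def)
  qed
  interpret Aut: group "AutoGroup G" by (rule AutoGroup)
  interpret \<psi>: group_hom G G \<psi> by (rule AutoGroup_group_hom[OF group_axioms \<psi>])
  let ?\<theta> = "inv\<^bsub>AutoGroup G\<^esub> \<psi>"
  have \<theta>: "?\<theta> \<in> carrier (AutoGroup G)" using \<psi> by simp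
  have inverse: "\<psi> (?\<theta> x) = x" if "x \<in> carrier G" for x
  proof -
    have "\<psi> \<otimes>\<^bsub>AutoGroup G\<^esub> ?\<theta> = (\<lambda>x\<in>carrier G. x)"
      using Aut.r_inv[OF \<psi>] by (simp only: AutoGroup_one)
    from fun_cong[OF this, of x] show ?thesis
      using that by (simp add: AutoGroup_mult[OF \<psi> \<theta>] compose_def)
  qed
  obtain h \<sigma> where h: "\<And>i. i \<in> I \<Longrightarrow> h i \<in> carrier G" and \<sigma>: "\<And>i. i \<in> I \<Longrightarrow> \<sigma> i \<in> I"
    and \<psi>_s: "\<And>i. i \<in> I \<Longrightarrow> \<psi> (s i) = h i \<otimes> s (\<sigma> i) \<otimes> inv (h i)"
    using *[OF \<psi>] by metis
  have "j \<in> \<sigma> ` I" if j: "j \<in> I" for j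
  proof -
    obtain k i where k: "k \<in> carrier G" "i \<in> I" "?\<theta> (s j) = k \<otimes> s i \<otimes> inv k"
      using *[OF \<theta> j] by blast
    then have "s j = \<psi> (k \<otimes> s i \<otimes> inv k)"
      using inverse[of "s j"] j by simp
    also have "\<dots> = (\<psi> k \<otimes> h i) \<otimes> s (\<sigma> i) \<otimes> inv (\<psi> k \<otimes> h i)"
      using k h \<sigma> by (simp add: \<psi>_s inv_mult_group m_assoc)
    finally have "\<sigma> i = j"
      using k h \<sigma> j by (intro conjugate_generators_eq[of _ _ "\<psi> k \<otimes> h i"]) auto
    with k(2) show ?thesis by blast
  qed
  with \<sigma> have "\<sigma> ` I = I" by blast
  with fin have "bij_betw \<sigma> I I"
    by (simp add: bij_betw_def eq_card_imp_inj_on)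
  then show ?thesis using that h \<psi>_s by blast
qed

end

locale free_product_of_three_involutions = free_product_of_involutions +
  assumes three: "3 \<le> card I"
begin

lemma avoid_two: "\<exists>c \<in> I. c \<noteq> a \<and> c \<noteq> b"
proof -
  have "card I \<le> card {a, b}" if "I \<subseteq> {a, b}"
    using that by (intro card_mono) auto
  moreover have "card {a, b} \<le> 2" by (simp add: card_insert_if)
  ultimately show ?thesis using three by fastforce
qed

text \<open>A letter \<open>c\<close> that differs from both ends of a reduced word \<open>w\<close> does not commute with it:
  there is no cancellation in \<open>c w c w\<^sup>-\<^sup>1\<close>.\<close>

lemma trivial_centre:
  assumes z: "z \<in> carrier G" and central: "\<forall>h \<in> carrier G. z \<otimes> h = h \<otimes> z"
  shows "z = \<one>"
proof (rule ccontr)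
  assume "z \<noteq> \<one>"
  obtain w where w: "w \<in> lists I" "distinct_adj w" "z = val w"
    using z by (rule reduced_word_exists)
  with \<open>z \<noteq> \<one>\<close> have "w \<noteq> []" by auto
  note w = w this
  obtain c where c: "c \<in> I" "c \<noteq> hd w" "c \<noteq> last w" using avoid_two by blast
  have "distinct_adj (c # w @ c # rev w)"
    using w c by (auto simp: distinct_adj_append_iff distinct_adj_Cons hd_append hd_rev)
  then have "val (c # w @ c # rev w) \<noteq> \<one>"
    using w c by (intro nontrivial_val) auto
  moreover have "val (c # w @ c # rev w) = s c \<otimes> (z \<otimes> s c) \<otimes> inv z"
    using w c by (simp add: val_append val_rev m_assoc)
  moreover have "\<dots> = s c \<otimes> s c \<otimes> (z \<otimes> inv z)"
    using central c z by (simp add: m_assoc)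
  ultimately show False using s_square[of c] c z by simp
qed

text \<open>If \<open>w\<close> is a nontrivial element of a normal subgroup, then so is a suitable conjugate
  \<open>u = c w c\<close> whose word starts and ends with the same letter \<open>c\<close>. The conjugates \<open>d u d\<close> and
  \<open>e u e\<close> by two further letters do not commute, as there is no cancellation in their commutator.\<close>

lemma trivial_normal_abelian:
  assumes N: "N \<lhd> G" and comm: "\<And>x y. x \<in> N \<Longrightarrow> y \<in> N \<Longrightarrow> x \<otimes> y = y \<otimes> x"
  shows "N = {\<one>}"
proof (rule ccontr)
  interpret N: normal N G by (rule N)
  assume "N \<noteq> {\<one>}"
  then obtain z where z: "z \<in> N" "z \<noteq> \<one>" using N.one_closed by blast
  obtain w where w: "w \<in> lists I" "distinct_adj w" "z = val w"
    using N.mem_carrier[OF z(1)] by (rule reduced_word_exists)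
  with z(2) have "w \<noteq> []" by auto
  note w = w this
  obtain c where c: "c \<in> I" "c \<noteq> hd w" "c \<noteq> last w" using avoid_two by blast
  obtain d where d: "d \<in> I" "d \<noteq> c" using avoid_two by blast
  obtain e where e: "e \<in> I" "e \<noteq> c" "e \<noteq> d" using avoid_two by blast
  define u where "u = c # w @ [c]"
  have u: "u \<in> lists I" "distinct_adj u" "u \<noteq> []" "hd u = c" "last u = c"
    using w c by (auto simp: u_def distinct_adj_append_iff distinct_adj_Cons)
  have conj: "s i \<otimes> x \<otimes> s i \<in> N" if "x \<in> N" "i \<in> I" for i x
    using N.inv_op_closed2[of "s i" x] that by (simp add: s_inv)
  have "val u \<in> N"
    using conj[of z c] z w c by (simp add: u_def val_append m_assoc)
  define p where "p = d # u @ [d]"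
  define q where "q = e # u @ [e]"
  have p: "p \<in> lists I" "distinct_adj p" "p \<noteq> []" "hd p = d" "last p = d"
    and q: "q \<in> lists I" "distinct_adj q" "q \<noteq> []" "hd q = e" "last q = e"
    using u d e by (simp_all add: p_def q_def distinct_adj_append_iff distinct_adj_Cons)
  have "val p \<in> N" "val q \<in> N"
    using conj[of "val u"] \<open>val u \<in> N\<close> u d e by (simp_all add: p_def q_def val_append m_assoc)
  then have "val p \<otimes> val q = val q \<otimes> val p"
    by (rule comm)
  then have "val (p @ q @ rev p @ rev q) = \<one>"
    using p q by (simp add: val_append val_rev m_assoc flip: inv_mult_group) (simp flip: m_assoc)
  moreover have "distinct_adj (p @ q @ rev p @ rev q)"
    using p q e(3) by (auto simp: distinct_adj_append_iff hd_append hd_rev last_rev)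
  moreover have "p @ q @ rev p @ rev q \<in> lists I" "p @ q @ rev p @ rev q \<noteq> []"
    using p q by simp_all
  ultimately show False using nontrivial_val by blast
qed

end

section \<open>The squares of the generators\<close>

context group
begin

lemma conj_mult:
  "g \<in> carrier G \<Longrightarrow> h \<in> carrier G \<Longrightarrow> y \<in> carrier G \<Longrightarrow>
    g \<otimes> h \<otimes> y \<otimes> inv (g \<otimes> h) = g \<otimes> (h \<otimes> y \<otimes> inv h) \<otimes> inv g"
  by (simp add: m_assoc inv_mult_group)

lemma conj_inv:
  "g \<in> carrier G \<Longrightarrow> y \<in> carrier G \<Longrightarrow> g \<otimes> inv y \<otimes> inv g = inv (g \<otimes> y \<otimes> inv g)"
  by (simp add: m_assoc inv_mult_group)

lemma conj_group_hom:
  assumes "g \<in> carrier G"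
  shows "group_hom G G (\<lambda>y. g \<otimes> y \<otimes> inv g)"
proof -
  have "inv g \<otimes> (g \<otimes> z) = z" if "z \<in> carrier G" for z
    using assms that by (simp flip: m_assoc)
  with assms show ?thesis
    by (auto simp: group_hom_def group_hom_axioms_def hom_def m_assoc)
qed

end

locale inverting_squares =
  fixes n :: nat
begin

abbreviation "G \<equiv> G_group n"
abbreviation "A \<equiv> A_set n"
abbreviation "x \<equiv> x_gen n"
abbreviation "q \<equiv> x_sq n"

sublocale group "G_group n"
  unfolding G_group_def by (rule presented_group_is_group)

lemma x_closed [simp]: "i < n \<Longrightarrow> x i \<in> carrier G"
  unfolding x_gen_def G_group_def by (rule pres_class_carrier) simp

lemma q_eq: "i < n \<Longrightarrow> q i = x i \<otimes>\<^bsub>G\<^esub> x i"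
  by (simp add: x_sq_def numeral_2_eq_2)

lemma q_closed [simp]: "i < n \<Longrightarrow> q i \<in> carrier G"
  by (simp add: q_eq)

lemma G_induct [consumes 1, case_names one gen gen_inv]:
  assumes "g \<in> carrier G" and "P \<one>\<^bsub>G\<^esub>"
    and "\<And>i g. i < n \<Longrightarrow> g \<in> carrier G \<Longrightarrow> P g \<Longrightarrow> P (x i \<otimes>\<^bsub>G\<^esub> g)"
    and "\<And>i g. i < n \<Longrightarrow> g \<in> carrier G \<Longrightarrow> P g \<Longrightarrow> P (inv\<^bsub>G\<^esub> x i \<otimes>\<^bsub>G\<^esub> g)"
  shows "P g"
  using assms unfolding G_group_def x_gen_def
  by (induction rule: presented_group_induct) auto

lemma G_hom_eqI:
  assumes "group H" "f \<in> hom G H" "g \<in> hom G H" "\<And>i. i < n \<Longrightarrow> f (x i) = g (x i)" "y \<in> carrier G"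
  shows "f y = g y"
proof -
  interpret f: group_hom G H f using assms by (simp add: group_hom_def group_hom_axioms_def)
  interpret g: group_hom G H g using assms by (simp add: group_hom_def group_hom_axioms_def)
  show ?thesis using assms(5) by (induction rule: G_induct) (simp_all add: assms(4))
qed

lemma x_relation:
  assumes "i < n" "j < n" "i \<noteq> j"
  shows "inv\<^bsub>G\<^esub> x i \<otimes>\<^bsub>G\<^esub> q j \<otimes>\<^bsub>G\<^esub> x i = inv\<^bsub>G\<^esub> q j"
proof -
  let ?S = "{..<n}" and ?R = "G_relations n"
  let ?u = "[(i, True), (j, False), (j, False), (i, False)]" and ?v = "[(j, True), (j, True)]"
  have "(?u, ?v) \<in> ?R" using assms by (auto simp: G_relations_def)
  moreover have uv: "?u \<in> lists (?S \<times> UNIV)" "?v \<in> lists (?S \<times> UNIV)" using assms by simp_all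
  ultimately have "pres_class ?S ?R ?u = pres_class ?S ?R ?v"
    using pres_eq.relation[of ?u ?v ?R ?S] by (subst pres_class_eq_iff) simp_all
  then have "word_eval G x ?u = word_eval G x ?v"
    using uv[THEN word_eval_presented_group, of ?R] unfolding G_group_def x_gen_def[abs_def]
    by (simp only:)
  then show ?thesis
    using assms by (simp add: q_eq m_assoc inv_mult_group)
qed

lemma G_hom_exists:
  assumes "group H" and f: "\<And>i. i < n \<Longrightarrow> f i \<in> carrier H"
    and rel: "\<And>i j. i < n \<Longrightarrow> j < n \<Longrightarrow> i \<noteq> j \<Longrightarrow>
      inv\<^bsub>H\<^esub> f i \<otimes>\<^bsub>H\<^esub> (f j \<otimes>\<^bsub>H\<^esub> f j) \<otimes>\<^bsub>H\<^esub> f i = inv\<^bsub>H\<^esub> (f j \<otimes>\<^bsub>H\<^esub> f j)"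
  obtains F where "F \<in> hom G H" "\<And>i. i < n \<Longrightarrow> F (x i) = f i"
proof -
  interpret H: group H by fact
  have "\<exists>F \<in> hom (presented_group {..<n} (G_relations n)) H.
      \<forall>s\<in>{..<n}. F (pres_class {..<n} (G_relations n) [(s, False)]) = f s"
  proof (rule H.presented_group_hom_exists)
    fix u v assume "(u, v) \<in> G_relations n"
    then obtain i j where ij: "i < n" "j < n" "i \<noteq> j"
      and u: "u = [(i, True), (j, False), (j, False), (i, False)]" and v: "v = [(j, True), (j, True)]"
      unfolding G_relations_def by blast
    show "word_eval H f u = word_eval H f v"
      using rel[OF ij] f ij by (simp add: u v H.m_assoc H.inv_mult_group)
  qed (use f in auto)
  then show ?thesis
    using that unfolding G_group_def x_gen_def by auto
qed

lemma conj_x_q: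
  assumes "i < n" "j < n"
  shows "inv\<^bsub>G\<^esub> x i \<otimes>\<^bsub>G\<^esub> q j \<otimes>\<^bsub>G\<^esub> x i = (if i = j then q j else inv\<^bsub>G\<^esub> q j)"
    and "x i \<otimes>\<^bsub>G\<^esub> q j \<otimes>\<^bsub>G\<^esub> inv\<^bsub>G\<^esub> x i = (if i = j then q j else inv\<^bsub>G\<^esub> q j)"
proof -
  show 1: "inv\<^bsub>G\<^esub> x i \<otimes>\<^bsub>G\<^esub> q j \<otimes>\<^bsub>G\<^esub> x i = (if i = j then q j else inv\<^bsub>G\<^esub> q j)"
    using assms x_relation by (simp add: q_eq flip: m_assoc)
  show "x i \<otimes>\<^bsub>G\<^esub> q j \<otimes>\<^bsub>G\<^esub> inv\<^bsub>G\<^esub> x i = (if i = j then q j else inv\<^bsub>G\<^esub> q j)"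
  proof (cases "i = j")
    case True
    then show ?thesis using assms by (simp add: q_eq m_assoc)
  next
    case False
    have "x i \<otimes>\<^bsub>G\<^esub> inv\<^bsub>G\<^esub> q j \<otimes>\<^bsub>G\<^esub> inv\<^bsub>G\<^esub> x i = q j"
      unfolding x_relation[OF assms False, symmetric] using assms
      by (simp add: m_assoc) (simp flip: m_assoc)
    then have "inv\<^bsub>G\<^esub> (x i \<otimes>\<^bsub>G\<^esub> q j \<otimes>\<^bsub>G\<^esub> inv\<^bsub>G\<^esub> x i) = q j"
      using assms by (simp add: conj_inv)
    then have "x i \<otimes>\<^bsub>G\<^esub> q j \<otimes>\<^bsub>G\<^esub> inv\<^bsub>G\<^esub> x i = inv\<^bsub>G\<^esub> q j"
      using assms by (metis inv_closed inv_inv m_closed q_closed x_closed)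
    with False show ?thesis by simp
  qed
qed

text \<open>The sign by which \<open>g\<close> acts on \<open>q\<^sub>j\<close> is the product of the signs of the letters of \<open>g\<close>.\<close>

lemma conj_q:
  assumes "g \<in> carrier G" "j < n"
  shows "g \<otimes>\<^bsub>G\<^esub> q j \<otimes>\<^bsub>G\<^esub> inv\<^bsub>G\<^esub> g \<in> {q j, inv\<^bsub>G\<^esub> q j}"
  using assms(1)
proof (induction rule: G_induct)
  case one
  then show ?case using assms(2) by simp
next
  case (gen i g)
  then show ?case
    using assms(2) conj_x_q(2)[of i j] conj_mult[of "x i" g "q j"] conj_inv[of "x i" "q j"]
    by (auto split: if_splits)
next
  case (gen_inv i g)
  then show ?case
    using assms(2) conj_x_q(1)[of i j] conj_mult[of "inv\<^bsub>G\<^esub> x i" g "q j"] conj_inv[of "inv\<^bsub>G\<^esub> x i" "q j"]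
    by (auto split: if_splits)
qed

lemma q_commute:
  assumes "i < n" "j < n"
  shows "q i \<otimes>\<^bsub>G\<^esub> q j = q j \<otimes>\<^bsub>G\<^esub> q i"
proof -
  have "q i \<otimes>\<^bsub>G\<^esub> q j \<otimes>\<^bsub>G\<^esub> inv\<^bsub>G\<^esub> q i = q j" if "i \<noteq> j"
    using assms that conj_mult[of "x i" "x i" "q j"] conj_x_q(2)[of i j] conj_inv[of "x i" "q j"]
    by (simp add: q_eq[of i])
  then show ?thesis
    using assms by (cases "i = j") (simp, metis inv_solve_right m_closed q_closed)
qed

lemma A_subgroup: "subgroup A G"
  unfolding A_set_def by (rule generate_is_subgroup) auto

lemma A_carrier: "a \<in> A \<Longrightarrow> a \<in> carrier G"
  using A_subgroup by (rule subgroup.mem_carrier)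

lemma q_in_A [simp]: "i < n \<Longrightarrow> q i \<in> A"
  unfolding A_set_def by (rule generate.incl) simp

lemma A_minimal: "subgroup H G \<Longrightarrow> (\<And>i. i < n \<Longrightarrow> q i \<in> H) \<Longrightarrow> A \<subseteq> H"
  unfolding A_set_def by (rule generate_subgroup_incl) auto

lemma A_normal: "A \<lhd> G"
  unfolding normal_inv_iff
proof (intro conjI ballI)
  interpret A: subgroup A G by (rule A_subgroup)
  fix g a assume g: "g \<in> carrier G" and a: "a \<in> A"
  interpret c: group_hom G G "\<lambda>y. g \<otimes>\<^bsub>G\<^esub> y \<otimes>\<^bsub>G\<^esub> inv\<^bsub>G\<^esub> g" by (rule conj_group_hom[OF g])
  have "subgroup {y \<in> carrier G. g \<otimes>\<^bsub>G\<^esub> y \<otimes>\<^bsub>G\<^esub> inv\<^bsub>G\<^esub> g \<in> A} G"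
    using g by unfold_locales (auto simp: c.hom_mult c.hom_inv)
  then have "A \<subseteq> {y \<in> carrier G. g \<otimes>\<^bsub>G\<^esub> y \<otimes>\<^bsub>G\<^esub> inv\<^bsub>G\<^esub> g \<in> A}"
  proof (rule A_minimal)
    fix i assume "i < n"
    then show "q i \<in> {y \<in> carrier G. g \<otimes>\<^bsub>G\<^esub> y \<otimes>\<^bsub>G\<^esub> inv\<^bsub>G\<^esub> g \<in> A}"
      using conj_q[OF g, of i] by auto
  qed
  with a show "g \<otimes>\<^bsub>G\<^esub> a \<otimes>\<^bsub>G\<^esub> inv\<^bsub>G\<^esub> g \<in> A" by blast
qed (rule A_subgroup)

lemma A_commute:
  assumes "a \<in> A" "b \<in> A"
  shows "a \<otimes>\<^bsub>G\<^esub> b = b \<otimes>\<^bsub>G\<^esub> a"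
proof -
  have centralizer: "subgroup {y \<in> carrier G. z \<otimes>\<^bsub>G\<^esub> y = y \<otimes>\<^bsub>G\<^esub> z} G" if z: "z \<in> carrier G" for z
  proof
    fix y assume "y \<in> {y \<in> carrier G. z \<otimes>\<^bsub>G\<^esub> y = y \<otimes>\<^bsub>G\<^esub> z}"
    with z show "inv\<^bsub>G\<^esub> y \<in> {y \<in> carrier G. z \<otimes>\<^bsub>G\<^esub> y = y \<otimes>\<^bsub>G\<^esub> z}"
      by (auto simp: inv_solve_left inv_solve_right m_assoc[symmetric])
  next
    fix y w assume "y \<in> {y \<in> carrier G. z \<otimes>\<^bsub>G\<^esub> y = y \<otimes>\<^bsub>G\<^esub> z}" "w \<in> {y \<in> carrier G. z \<otimes>\<^bsub>G\<^esub> y = y \<otimes>\<^bsub>G\<^esub> z}"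
    with z show "y \<otimes>\<^bsub>G\<^esub> w \<in> {y \<in> carrier G. z \<otimes>\<^bsub>G\<^esub> y = y \<otimes>\<^bsub>G\<^esub> z}"
      using m_assoc[of z y w] m_assoc[of y z w] m_assoc[of y w z] by auto
  qed (use z in auto)
  have "A \<subseteq> {y \<in> carrier G. q i \<otimes>\<^bsub>G\<^esub> y = y \<otimes>\<^bsub>G\<^esub> q i}" if "i < n" for i
    using that q_commute by (intro A_minimal centralizer) auto
  then have "A \<subseteq> {y \<in> carrier G. b \<otimes>\<^bsub>G\<^esub> y = y \<otimes>\<^bsub>G\<^esub> b}"
    using assms(2) A_carrier[OF assms(2)] by (intro A_minimal centralizer) auto
  with assms(1) show ?thesis by auto
qed

end

section \<open>Coordinates on the subgroup \<open>A\<close>\<close>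

lemma (in group_hom) hom_foldr_mult:
  assumes "set ys \<subseteq> carrier G"
  shows "h (foldr (\<otimes>) ys \<one>) = foldr (\<otimes>\<^bsub>H\<^esub>) (map h ys) \<one>\<^bsub>H\<^esub>"
proof -
  have "foldr (\<otimes>) ys \<one> \<in> carrier G \<and> h (foldr (\<otimes>) ys \<one>) = foldr (\<otimes>\<^bsub>H\<^esub>) (map h ys) \<one>\<^bsub>H\<^esub>"
    using assms by (induction ys) auto
  then show ?thesis by blast
qed

lemma (in group) foldr_mult_single:
  assumes "distinct js" "g \<in> carrier G"
  shows "foldr (\<otimes>) (map (\<lambda>j. if j = i then g else \<one>) js) \<one> = (if i \<in> set js then g else \<one>)"
  using assms by (induction js) auto

text \<open>The infinite dihedral group, as \<open>\<int> \<rtimes> C\<^sub>2\<close>.\<close>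

definition dihedral :: "(int \<times> bool) monoid" where
  "dihedral = \<lparr>carrier = UNIV,
     monoid.mult = (\<lambda>(a, p) (b, r). (if p then a - b else a + b, p \<noteq> r)),
     one = (0, False)\<rparr>"

lemma dihedral_simps [simp]:
  "carrier dihedral = UNIV"
  "(a, p) \<otimes>\<^bsub>dihedral\<^esub> (b, r) = (if p then a - b else a + b, p \<noteq> r)"
  "\<one>\<^bsub>dihedral\<^esub> = (0, False)"
  by (simp_all add: dihedral_def)

lemma dihedral_group: "group dihedral"
proof (rule groupI)
  fix d assume "d \<in> carrier dihedral"
  obtain a p where "d = (a, p)" by (cases d)
  then show "\<exists>e\<in>carrier dihedral. e \<otimes>\<^bsub>dihedral\<^esub> d = \<one>\<^bsub>dihedral\<^esub>"
    by (intro bexI[of _ "(if p then a else - a, p)"]) auto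
qed (auto split: if_splits)

lemma dihedral_inv: "inv\<^bsub>dihedral\<^esub> (a, p) = (if p then a else - a, p)"
  by (rule group.inv_equality[OF dihedral_group]) auto

lemma dihedral_int_pow: "(a, False) [^]\<^bsub>dihedral\<^esub> (k::int) = (k * a, False)"
proof -
  have "(a, False) [^]\<^bsub>dihedral\<^esub> m = (int m * a, False)" for m :: nat
    by (induction m) (simp_all add: nat_pow_def algebra_simps)
  then show ?thesis
    by (simp add: int_pow_def2 dihedral_inv)
qed

context inverting_squares
begin

lemma A_int_pow: "a \<in> A \<Longrightarrow> a [^]\<^bsub>G\<^esub> (k::int) \<in> A"
  using A_subgroup by (rule subgroup_int_pow_closed)

lemma sq_list_mult:
  fixes c d :: "nat \<Rightarrow> int"
  assumes "set js \<subseteq> {..<n}"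
  shows "foldr (\<otimes>\<^bsub>G\<^esub>) (map (\<lambda>j. q j [^]\<^bsub>G\<^esub> (c j + d j)) js) \<one>\<^bsub>G\<^esub> =
      foldr (\<otimes>\<^bsub>G\<^esub>) (map (\<lambda>j. q j [^]\<^bsub>G\<^esub> c j) js) \<one>\<^bsub>G\<^esub> \<otimes>\<^bsub>G\<^esub>
      foldr (\<otimes>\<^bsub>G\<^esub>) (map (\<lambda>j. q j [^]\<^bsub>G\<^esub> d j) js) \<one>\<^bsub>G\<^esub>"
    and "foldr (\<otimes>\<^bsub>G\<^esub>) (map (\<lambda>j. q j [^]\<^bsub>G\<^esub> c j) js) \<one>\<^bsub>G\<^esub> \<in> A"
proof -
  interpret A: subgroup A G by (rule A_subgroup)
  have in_A: "foldr (\<otimes>\<^bsub>G\<^esub>) (map (\<lambda>j. q j [^]\<^bsub>G\<^esub> e j) js) \<one>\<^bsub>G\<^esub> \<in> A"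
    if "set js \<subseteq> {..<n}" for e :: "nat \<Rightarrow> int" and js
    using that by (induction js) (simp_all add: A_int_pow)
  show "foldr (\<otimes>\<^bsub>G\<^esub>) (map (\<lambda>j. q j [^]\<^bsub>G\<^esub> c j) js) \<one>\<^bsub>G\<^esub> \<in> A"
    using assms by (rule in_A)
  show "foldr (\<otimes>\<^bsub>G\<^esub>) (map (\<lambda>j. q j [^]\<^bsub>G\<^esub> (c j + d j)) js) \<one>\<^bsub>G\<^esub> =
      foldr (\<otimes>\<^bsub>G\<^esub>) (map (\<lambda>j. q j [^]\<^bsub>G\<^esub> c j) js) \<one>\<^bsub>G\<^esub> \<otimes>\<^bsub>G\<^esub>
      foldr (\<otimes>\<^bsub>G\<^esub>) (map (\<lambda>j. q j [^]\<^bsub>G\<^esub> d j) js) \<one>\<^bsub>G\<^esub>"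
    using assms
  proof (induction js)
    case (Cons j js)
    let ?P = "\<lambda>e. foldr (\<otimes>\<^bsub>G\<^esub>) (map (\<lambda>j. q j [^]\<^bsub>G\<^esub> e j) js) \<one>\<^bsub>G\<^esub>"
    have j: "j < n" and js: "set js \<subseteq> {..<n}" using Cons.prems by auto
    have P: "?P c \<in> A" "?P d \<in> A" using in_A[OF js] by auto
    have "q j [^]\<^bsub>G\<^esub> d j \<otimes>\<^bsub>G\<^esub> ?P c = ?P c \<otimes>\<^bsub>G\<^esub> q j [^]\<^bsub>G\<^esub> d j"
      using P j by (intro A_commute) (simp_all add: A_int_pow)
    then have "q j [^]\<^bsub>G\<^esub> c j \<otimes>\<^bsub>G\<^esub> (q j [^]\<^bsub>G\<^esub> d j \<otimes>\<^bsub>G\<^esub> ?P c) \<otimes>\<^bsub>G\<^esub> ?P d =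
        q j [^]\<^bsub>G\<^esub> c j \<otimes>\<^bsub>G\<^esub> (?P c \<otimes>\<^bsub>G\<^esub> q j [^]\<^bsub>G\<^esub> d j) \<otimes>\<^bsub>G\<^esub> ?P d"
      by simp
    then show ?case
      using Cons.IH[OF js] P[THEN A_carrier] j by (simp add: int_pow_mult m_assoc)
  qed simp
qed

lemma sq_prod_in_A [simp]: "sq_prod n c \<in> A"
  unfolding sq_prod_def by (rule sq_list_mult) auto

lemma sq_prod_closed [simp]: "sq_prod n c \<in> carrier G"
  by (rule A_carrier) simp

lemma sq_prod_add: "sq_prod n (\<lambda>j. c j + d j) = sq_prod n c \<otimes>\<^bsub>G\<^esub> sq_prod n d"
  unfolding sq_prod_def by (rule sq_list_mult) auto

lemma sq_prod_cong: "(\<And>j. j < n \<Longrightarrow> c j = d j) \<Longrightarrow> sq_prod n c = sq_prod n d"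
  unfolding sq_prod_def by (intro arg_cong2[of _ _ _ _ "\<lambda>ys. foldr _ ys"] map_cong) auto

lemma sq_prod_zero: "sq_prod n (\<lambda>j. 0) = \<one>\<^bsub>G\<^esub>"
proof -
  have "foldr (\<otimes>\<^bsub>G\<^esub>) (map (\<lambda>j. q j [^]\<^bsub>G\<^esub> (0::int)) js) \<one>\<^bsub>G\<^esub> = \<one>\<^bsub>G\<^esub>" for js
    by (induction js) auto
  then show ?thesis by (simp add: sq_prod_def)
qed

lemma sq_prod_uminus: "sq_prod n (\<lambda>j. - c j) = inv\<^bsub>G\<^esub> sq_prod n c"
  using sq_prod_add[of "\<lambda>j. - c j" c] by (intro HOL.sym[OF inv_equality]) (simp_all add: sq_prod_zero)

lemma hom_sq_prod:
  assumes "group_hom G H h"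
  shows "h (sq_prod n c) = foldr (\<otimes>\<^bsub>H\<^esub>) (map (\<lambda>j. h (q j) [^]\<^bsub>H\<^esub> c j) [0..<n]) \<one>\<^bsub>H\<^esub>"
proof -
  interpret group_hom G H h by fact
  have "h (sq_prod n c) = foldr (\<otimes>\<^bsub>H\<^esub>) (map h (map (\<lambda>j. q j [^]\<^bsub>G\<^esub> c j) [0..<n])) \<one>\<^bsub>H\<^esub>"
    unfolding sq_prod_def by (rule hom_foldr_mult) auto
  moreover have "map h (map (\<lambda>j. q j [^]\<^bsub>G\<^esub> c j) [0..<n]) = map (\<lambda>j. h (q j) [^]\<^bsub>H\<^esub> c j) [0..<n]"
    by (simp add: hom_int_pow)
  ultimately show ?thesis by (simp only:)
qed

text \<open>A homomorphism that kills all but one of the \<open>q\<^sub>j\<close> reads off one exponent.\<close>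

lemma hom_sq_prod_single:
  assumes h: "group_hom G H h" and i: "i < n" and triv: "\<And>j. j < n \<Longrightarrow> j \<noteq> i \<Longrightarrow> h (q j) = \<one>\<^bsub>H\<^esub>"
  shows "h (sq_prod n c) = h (q i) [^]\<^bsub>H\<^esub> c i"
proof -
  interpret h: group_hom G H h by fact
  have *: "map (\<lambda>j. h (q j) [^]\<^bsub>H\<^esub> c j) [0..<n] =
      map (\<lambda>j. if j = i then h (q i) [^]\<^bsub>H\<^esub> c i else \<one>\<^bsub>H\<^esub>) [0..<n]"
    using triv by auto
  show ?thesis
    unfolding hom_sq_prod[OF h] * using i by (subst h.H.foldr_mult_single) simp_all
qed

lemma hom_sq_prod_powers:
  assumes h: "group_hom G G h" and e: "\<And>j. j < n \<Longrightarrow> h (q j) = q j [^]\<^bsub>G\<^esub> e j"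
  shows "h (sq_prod n c) = sq_prod n (\<lambda>j. e j * c j)"
proof -
  have *: "map (\<lambda>j. h (q j) [^]\<^bsub>G\<^esub> c j) [0..<n] = map (\<lambda>j. q j [^]\<^bsub>G\<^esub> (e j * c j)) [0..<n]"
    by (simp add: e int_pow_pow)
  show ?thesis
    unfolding hom_sq_prod[OF h] * by (simp only: sq_prod_def)
qed

lemma sq_prod_single: "i < n \<Longrightarrow> sq_prod n (\<lambda>j. if j = i then k else 0) = q i [^]\<^bsub>G\<^esub> k"
proof -
  assume i: "i < n"
  have *: "map (\<lambda>j. q j [^]\<^bsub>G\<^esub> (if j = i then k else 0)) [0..<n] =
      map (\<lambda>j. if j = i then q i [^]\<^bsub>G\<^esub> k else \<one>\<^bsub>G\<^esub>) [0..<n]"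
    by auto
  show ?thesis
    unfolding sq_prod_def * using i by (subst foldr_mult_single) simp_all
qed

lemma A_eq_range_sq_prod: "A = range (sq_prod n)"
proof
  have "subgroup (range (sq_prod n)) G"
    by unfold_locales (auto simp: sq_prod_zero[symmetric] sq_prod_add[symmetric] sq_prod_uminus[symmetric])
  moreover have "q i \<in> range (sq_prod n)" if "i < n" for i
    using sq_prod_single[OF that, of 1] that by (metis int_pow_1 q_closed rangeI)
  ultimately show "A \<subseteq> range (sq_prod n)" by (rule A_minimal)
qed auto

lemma A_cases:
  assumes "a \<in> A"
  obtains c where "a = sq_prod n c"
  using assms unfolding A_eq_range_sq_prod by blast

text \<open>The homomorphism that sends \<open>x\<^sub>j\<close> to a translation and all other generators to a
  reflection respects the relations. It reads off the \<open>j\<close>-th exponent.\<close>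

lemma coordinate_hom_exists:
  assumes j: "j < n"
  shows "\<exists>F. group_hom G dihedral F \<and> F (q j) = (2, False) \<and>
    (\<forall>i<n. i \<noteq> j \<longrightarrow> F (q i) = \<one>\<^bsub>dihedral\<^esub>)"
proof -
  obtain F where F: "F \<in> hom G dihedral"
      "\<And>i. i < n \<Longrightarrow> F (x i) = (if i = j then (1, False) else (0, True))"
    by (rule G_hom_exists[OF dihedral_group, of "\<lambda>i. if i = j then (1, False) else (0, True)"])
      (auto simp: dihedral_inv split: if_splits)
  then interpret F: group_hom G dihedral F
    by (simp add: group_hom_def group_hom_axioms_def dihedral_group)
  show ?thesis
    using F(2) j F.group_hom_axioms by (intro exI[of _ F]) (simp add: q_eq)
qed

lemma sq_prod_inject:
  assumes "sq_prod n c = sq_prod n d" "j < n"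
  shows "c j = d j"
proof -
  obtain F where F: "group_hom G dihedral F" "F (q j) = (2, False)"
    "\<And>i. i < n \<Longrightarrow> i \<noteq> j \<Longrightarrow> F (q i) = \<one>\<^bsub>dihedral\<^esub>"
    using coordinate_hom_exists[OF assms(2)] by blast
  have "F (sq_prod n e) = (e j * 2, False)" for e
    using hom_sq_prod_single[OF F(1) assms(2) F(3), of e] by (simp add: F(2) dihedral_int_pow)
  from this[of c] this[of d] show ?thesis using assms(1) by simp
qed

lemma conj_sq_prod:
  assumes i: "i < n"
  shows "x i \<otimes>\<^bsub>G\<^esub> sq_prod n c \<otimes>\<^bsub>G\<^esub> inv\<^bsub>G\<^esub> x i = sq_prod n (\<lambda>j. (if j = i then 1 else - 1) * c j)"
    and "inv\<^bsub>G\<^esub> x i \<otimes>\<^bsub>G\<^esub> sq_prod n c \<otimes>\<^bsub>G\<^esub> x i = sq_prod n (\<lambda>j. (if j = i then 1 else - 1) * c j)"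
proof -
  have e: "(if i = j then q j else inv\<^bsub>G\<^esub> q j) = q j [^]\<^bsub>G\<^esub> (if j = i then 1 else - 1 :: int)" if "j < n" for j
    using that by (simp add: int_pow_neg)
  show "x i \<otimes>\<^bsub>G\<^esub> sq_prod n c \<otimes>\<^bsub>G\<^esub> inv\<^bsub>G\<^esub> x i = sq_prod n (\<lambda>j. (if j = i then 1 else - 1) * c j)"
    using i e conj_x_q(2)[OF i] by (intro hom_sq_prod_powers conj_group_hom) simp_all
  show "inv\<^bsub>G\<^esub> x i \<otimes>\<^bsub>G\<^esub> sq_prod n c \<otimes>\<^bsub>G\<^esub> x i = sq_prod n (\<lambda>j. (if j = i then 1 else - 1) * c j)"
    using i e conj_x_q(1)[OF i] hom_sq_prod_powers[OF conj_group_hom[of "inv\<^bsub>G\<^esub> x i"], of _ c] by simp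
qed

section \<open>The quotient \<open>W\<close> is a free product\<close>

abbreviation "W \<equiv> W_group n"
abbreviation "w \<equiv> quot_map G A"

lemma w_group_hom: "group_hom G W w"
  unfolding W_group_def by (rule quot_map_group_hom[OF A_normal])

lemma w_eq_one_iff: "g \<in> carrier G \<Longrightarrow> w g = \<one>\<^bsub>W\<^esub> \<longleftrightarrow> g \<in> A"
  unfolding W_group_def by (rule quot_map_eq_one_iff[OF A_normal])

lemma w_eq_iff: "g \<in> carrier G \<Longrightarrow> h \<in> carrier G \<Longrightarrow> w g = w h \<longleftrightarrow> (\<exists>a\<in>A. g = h \<otimes>\<^bsub>G\<^esub> a)"
proof -
  assume gh: "g \<in> carrier G" "h \<in> carrier G"
  interpret w: group_hom G W w by (rule w_group_hom)
  have "w g = w h \<longleftrightarrow> w (inv\<^bsub>G\<^esub> h \<otimes>\<^bsub>G\<^esub> g) = \<one>\<^bsub>W\<^esub>"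
    using gh by (simp add: w.H.inv_solve_left'[symmetric] eq_commute)
  also have "\<dots> \<longleftrightarrow> inv\<^bsub>G\<^esub> h \<otimes>\<^bsub>G\<^esub> g \<in> A"
    using gh by (simp only: w_eq_one_iff m_closed inv_closed)
  also have "\<dots> \<longleftrightarrow> (\<exists>a\<in>A. g = h \<otimes>\<^bsub>G\<^esub> a)"
  proof
    assume "inv\<^bsub>G\<^esub> h \<otimes>\<^bsub>G\<^esub> g \<in> A"
    then show "\<exists>a\<in>A. g = h \<otimes>\<^bsub>G\<^esub> a"
      using gh by (intro bexI[of _ "inv\<^bsub>G\<^esub> h \<otimes>\<^bsub>G\<^esub> g"]) (simp_all flip: m_assoc)
  next
    assume "\<exists>a\<in>A. g = h \<otimes>\<^bsub>G\<^esub> a"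
    then obtain a where "a \<in> A" "g = h \<otimes>\<^bsub>G\<^esub> a" by blast
    then show "inv\<^bsub>G\<^esub> h \<otimes>\<^bsub>G\<^esub> g \<in> A"
      using gh A_carrier[of a] by (simp flip: m_assoc)
  qed
  finally show ?thesis .
qed

lemma carrier_W: "carrier W = w ` carrier G"
  unfolding W_group_def by (rule carrier_quotient)

text \<open>Left multiplication by a generator, on reduced words.\<close>

definition toggle :: "nat \<Rightarrow> nat list \<Rightarrow> nat list" where
  "toggle i v = (if v \<noteq> [] \<and> hd v = i then tl v else i # v)"

text \<open>Van der Waerden's trick: \<open>G\<close> acts on the reduced words, with \<open>A\<close> in the kernel.\<close>

lemma reduced_word_action:
  fixes R
  defines "R \<equiv> {v \<in> lists {..<n}. distinct_adj v}"
  shows "\<exists>F. group_hom G (BijGroup R) F \<and> (\<forall>i<n. F (x i) = restrict (toggle i) R) \<and>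
    (\<forall>a\<in>A. F a = \<one>\<^bsub>BijGroup R\<^esub>)"
proof -
  let ?R = R
  let ?B = "BijGroup ?R"
  let ?f = "\<lambda>i. restrict (toggle i) ?R"
  interpret B: group ?B by (rule group_BijGroup)
  have tR: "toggle i v \<in> ?R" if "i < n" "v \<in> ?R" for i v
    using that by (cases v) (auto simp: R_def toggle_def distinct_adj_Cons)
  have tt: "toggle i (toggle i v) = v" if "v \<in> ?R" for i v
    using that by (cases v; cases "tl v") (auto simp: R_def toggle_def)
  have f: "?f i \<in> carrier ?B" if "i < n" for i
    using tR[OF that] tt by (auto simp: BijGroup_def Bij_def intro!: bij_betwI[where g = "toggle i"])
  have ff: "?f i \<otimes>\<^bsub>?B\<^esub> ?f i = \<one>\<^bsub>?B\<^esub>" if "i < n" for i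
    using f[OF that] tR[OF that] tt by (auto simp: BijGroup_def compose_def intro!: restrict_ext)
  obtain F where F: "F \<in> hom G ?B" "\<And>i. i < n \<Longrightarrow> F (x i) = ?f i"
    by (rule G_hom_exists[OF B.group_axioms, of ?f]) (use f ff in simp_all)
  then interpret F: group_hom G ?B F by (simp add: group_hom_def group_hom_axioms_def)
  have "A \<subseteq> kernel G ?B F"
    using F.subgroup_kernel F(2) ff by (intro A_minimal) (simp_all add: kernel_def q_eq)
  then show ?thesis
    using F(2) F.group_hom_axioms by (intro exI[of _ F]) (auto simp: kernel_def)
qed

lemma W_free_product: "free_product_of_involutions W {..<n} (\<lambda>i. w (x i))"
proof -
  interpret w: group_hom G W w by (rule w_group_hom)
  have foldr_w: "foldr (\<lambda>i. (\<otimes>\<^bsub>W\<^esub>) (w (x i))) v \<one>\<^bsub>W\<^esub> = w (foldr (\<lambda>i. (\<otimes>\<^bsub>G\<^esub>) (x i)) v \<one>\<^bsub>G\<^esub>)"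
    and foldr_closed: "foldr (\<lambda>i. (\<otimes>\<^bsub>G\<^esub>) (x i)) v \<one>\<^bsub>G\<^esub> \<in> carrier G"
    if "v \<in> lists {..<n}" for v
    using that by (induction v) auto
  have square: "w (x i) \<otimes>\<^bsub>W\<^esub> w (x i) = \<one>\<^bsub>W\<^esub>" if "i < n" for i
    using that w_eq_one_iff[of "q i"] q_in_A[OF that] by (simp add: q_eq)
  show ?thesis
  proof
    show "carrier W \<subseteq> (\<lambda>v. foldr (\<lambda>i. (\<otimes>\<^bsub>W\<^esub>) (w (x i))) v \<one>\<^bsub>W\<^esub>) ` lists {..<n}"
    proof -
      have "w g \<in> (\<lambda>v. foldr (\<lambda>i. (\<otimes>\<^bsub>W\<^esub>) (w (x i))) v \<one>\<^bsub>W\<^esub>) ` lists {..<n}" if "g \<in> carrier G" for g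
        using that
      proof (induction rule: G_induct)
        case one
        then show ?case by (auto intro!: image_eqI[of _ _ "[]"])
      next
        case (gen i g)
        then obtain v where "v \<in> lists {..<n}" "w g = foldr (\<lambda>i. (\<otimes>\<^bsub>W\<^esub>) (w (x i))) v \<one>\<^bsub>W\<^esub>" by blast
        then show ?case using gen by (intro image_eqI[of _ _ "i # v"]) auto
      next
        case (gen_inv i g)
        then obtain v where "v \<in> lists {..<n}" "w g = foldr (\<lambda>i. (\<otimes>\<^bsub>W\<^esub>) (w (x i))) v \<one>\<^bsub>W\<^esub>" by blast
        moreover have "inv\<^bsub>W\<^esub> w (x i) = w (x i)"
          using gen_inv square by (intro w.H.inv_equality) auto
        ultimately show ?case using gen_inv by (intro image_eqI[of _ _ "i # v"]) auto
      qed
      then show ?thesis by (auto simp: carrier_W)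
    qed
  next
    fix v :: "nat list" assume v: "v \<in> lists {..<n}" "distinct_adj v" "v \<noteq> []"
    let ?R = "{v \<in> lists {..<n}. distinct_adj v}"
    obtain F where F: "group_hom G (BijGroup ?R) F"
      "\<And>i. i < n \<Longrightarrow> F (x i) = restrict (toggle i) ?R" "\<And>a. a \<in> A \<Longrightarrow> F a = \<one>\<^bsub>BijGroup ?R\<^esub>"
      using reduced_word_action by blast
    interpret F: group_hom G "BijGroup ?R" F by (rule F(1))
    have mult: "(f \<otimes>\<^bsub>BijGroup ?R\<^esub> g) [] = f (g [])"
      if "f \<in> carrier (BijGroup ?R)" "g \<in> carrier (BijGroup ?R)" for f g
      using that by (auto simp: BijGroup_def compose_def)
    have "F (foldr (\<lambda>i. (\<otimes>\<^bsub>G\<^esub>) (x i)) u \<one>\<^bsub>G\<^esub>) [] = u" if "u \<in> lists {..<n}" "distinct_adj u" for u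
      using that
    proof (induction u)
      case Nil
      then show ?case by (simp add: BijGroup_def)
    next
      case (Cons i u)
      then have u: "u \<in> lists {..<n}" "distinct_adj u" "i < n" by (auto dest: distinct_adj_ConsD)
      have "F (foldr (\<lambda>i. (\<otimes>\<^bsub>G\<^esub>) (x i)) (i # u) \<one>\<^bsub>G\<^esub>) [] =
          F (x i) (F (foldr (\<lambda>i. (\<otimes>\<^bsub>G\<^esub>) (x i)) u \<one>\<^bsub>G\<^esub>) [])"
        using u foldr_closed[OF u(1)] F.hom_closed by (simp add: mult)
      also have "\<dots> = toggle i u"
        using u Cons.IH F(2)[of i] by simp
      also have "\<dots> = i # u"
        using Cons.prems by (cases u) (auto simp: toggle_def)
      finally show ?case .
    qed
    from this[OF v(1,2)] have "F (foldr (\<lambda>i. (\<otimes>\<^bsub>G\<^esub>) (x i)) v \<one>\<^bsub>G\<^esub>) \<noteq> \<one>\<^bsub>BijGroup ?R\<^esub>"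
      using v(3) by (auto simp: BijGroup_def)
    then have "foldr (\<lambda>i. (\<otimes>\<^bsub>G\<^esub>) (x i)) v \<one>\<^bsub>G\<^esub> \<notin> A" using F(3) by blast
    then show "foldr (\<lambda>i. (\<otimes>\<^bsub>W\<^esub>) (w (x i))) v \<one>\<^bsub>W\<^esub> \<noteq> \<one>\<^bsub>W\<^esub>"
      using v(1) by (simp add: foldr_w foldr_closed w_eq_one_iff)
  qed (use square in auto)
qed

end

section \<open>The monoid \<open>M\<close> and its action by endomorphisms\<close>

lemma M_monoid_simps:
  "carrier (M_monoid n) = carrier_mat n n"
  "\<one>\<^bsub>M_monoid n\<^esub> = 0\<^sub>m n n"
  by (simp_all add: M_monoid_def)

lemma M_mult_dim [simp]:
  "dim_row (a \<otimes>\<^bsub>M_monoid n\<^esub> b) = n" "dim_col (a \<otimes>\<^bsub>M_monoid n\<^esub> b) = n"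
  by (simp_all add: M_monoid_def)

lemma M_mult_carrier [simp]: "a \<otimes>\<^bsub>M_monoid n\<^esub> b \<in> carrier_mat n n"
  by (intro carrier_matI) simp_all

lemma M_mult_index [simp]:
  "i < n \<Longrightarrow> j < n \<Longrightarrow>
    (a \<otimes>\<^bsub>M_monoid n\<^esub> b) $$ (i, j) = a $$ (i, j) + (1 + 2 * a $$ (j, j)) * b $$ (i, j)"
  by (simp add: M_monoid_def)

lemma M_monoid_monoid: "monoid (M_monoid n)"
proof
  fix a b c
  show "a \<otimes>\<^bsub>M_monoid n\<^esub> b \<otimes>\<^bsub>M_monoid n\<^esub> c = a \<otimes>\<^bsub>M_monoid n\<^esub> (b \<otimes>\<^bsub>M_monoid n\<^esub> c)"
  proof (rule eq_matI)
    fix i j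
    assume "i < dim_row (a \<otimes>\<^bsub>M_monoid n\<^esub> (b \<otimes>\<^bsub>M_monoid n\<^esub> c))"
      "j < dim_col (a \<otimes>\<^bsub>M_monoid n\<^esub> (b \<otimes>\<^bsub>M_monoid n\<^esub> c))"
    then have "i < n" "j < n" by simp_all
    then show "(a \<otimes>\<^bsub>M_monoid n\<^esub> b \<otimes>\<^bsub>M_monoid n\<^esub> c) $$ (i, j) =
        (a \<otimes>\<^bsub>M_monoid n\<^esub> (b \<otimes>\<^bsub>M_monoid n\<^esub> c)) $$ (i, j)"
      by (simp add: distrib_left distrib_right)
  qed simp_all
next
  fix a assume "a \<in> carrier (M_monoid n)"
  then have a: "a \<in> carrier_mat n n" by (simp add: M_monoid_simps)
  show "\<one>\<^bsub>M_monoid n\<^esub> \<otimes>\<^bsub>M_monoid n\<^esub> a = a" "a \<otimes>\<^bsub>M_monoid n\<^esub> \<one>\<^bsub>M_monoid n\<^esub> = a"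
    using a by (auto intro!: eq_matI simp: M_monoid_simps M_monoid_def)
qed (simp_all add: M_monoid_simps)

lemma M_units_simps:
  "carrier (M_units n) = Units (M_monoid n)"
  "a \<otimes>\<^bsub>M_units n\<^esub> b = a \<otimes>\<^bsub>M_monoid n\<^esub> b"
  "\<one>\<^bsub>M_units n\<^esub> = 0\<^sub>m n n"
  by (simp_all add: M_units_def units_of_def M_monoid_simps)

lemma M_units_group: "group (M_units n)"
  unfolding M_units_def by (rule monoid.units_group[OF M_monoid_monoid])

lemma M_units_carrier_mat: "a \<in> carrier (M_units n) \<Longrightarrow> a \<in> carrier_mat n n"
  by (simp add: M_units_simps Units_def M_monoid_simps)

lemma M_unitI:
  assumes "a \<in> carrier_mat n n" "b \<in> carrier_mat n n"
    and "a \<otimes>\<^bsub>M_monoid n\<^esub> b = 0\<^sub>m n n" "b \<otimes>\<^bsub>M_monoid n\<^esub> a = 0\<^sub>m n n"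
  shows "a \<in> carrier (M_units n)"
  using assms by (auto simp: M_units_simps Units_def M_monoid_simps)

context inverting_squares
begin

text \<open>Conjugation by \<open>x\<^sub>j\<close> negates all coordinates of \<open>A\<close> but the \<open>j\<close>-th, so all others cancel in
  \<open>(x\<^sub>j a)\<^sup>2 = x\<^sub>j\<^sup>2 (x\<^sub>j\<^sup>-\<^sup>1 a x\<^sub>j) a\<close>.\<close>

lemma square_x_sq_prod:
  assumes "j < n"
  shows "x j \<otimes>\<^bsub>G\<^esub> sq_prod n c \<otimes>\<^bsub>G\<^esub> (x j \<otimes>\<^bsub>G\<^esub> sq_prod n c) = q j [^]\<^bsub>G\<^esub> (1 + 2 * c j)"
proof -
  have "inv\<^bsub>G\<^esub> x j \<otimes>\<^bsub>G\<^esub> sq_prod n c \<otimes>\<^bsub>G\<^esub> x j \<otimes>\<^bsub>G\<^esub> sq_prod n c = sq_prod n (\<lambda>i. if i = j then 2 * c j else 0)"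
    unfolding conj_sq_prod(2)[OF assms] sq_prod_add[symmetric] by (rule sq_prod_cong) simp
  then have "inv\<^bsub>G\<^esub> x j \<otimes>\<^bsub>G\<^esub> sq_prod n c \<otimes>\<^bsub>G\<^esub> x j \<otimes>\<^bsub>G\<^esub> sq_prod n c = q j [^]\<^bsub>G\<^esub> (2 * c j)"
    using assms by (simp only: sq_prod_single)
  then have "q j \<otimes>\<^bsub>G\<^esub> (inv\<^bsub>G\<^esub> x j \<otimes>\<^bsub>G\<^esub> sq_prod n c \<otimes>\<^bsub>G\<^esub> x j \<otimes>\<^bsub>G\<^esub> sq_prod n c) = q j [^]\<^bsub>G\<^esub> (1 + 2 * c j)"
    using assms by (simp add: int_pow_mult)
  moreover have "x j \<otimes>\<^bsub>G\<^esub> (inv\<^bsub>G\<^esub> x j \<otimes>\<^bsub>G\<^esub> y) = y" if "y \<in> carrier G" for y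
    using that assms by (simp flip: m_assoc)
  ultimately show ?thesis
    using assms by (simp add: q_eq m_assoc)
qed

text \<open>Together with the previous lemma this shows that the elements \<open>x\<^sub>i a\<^sub>i\<close> with \<open>a\<^sub>i \<in> A\<close> satisfy the relations of
  the \<open>x\<^sub>i\<close>.\<close>

lemma conj_x_sq_prod_q_pow:
  assumes "i < n" "j < n" "i \<noteq> j"
  shows "inv\<^bsub>G\<^esub> (x i \<otimes>\<^bsub>G\<^esub> sq_prod n c) \<otimes>\<^bsub>G\<^esub> q j [^]\<^bsub>G\<^esub> (k::int) \<otimes>\<^bsub>G\<^esub> (x i \<otimes>\<^bsub>G\<^esub> sq_prod n c) =
    inv\<^bsub>G\<^esub> (q j [^]\<^bsub>G\<^esub> k)"
proof -
  let ?y = "inv\<^bsub>G\<^esub> x i \<otimes>\<^bsub>G\<^esub> q j [^]\<^bsub>G\<^esub> k \<otimes>\<^bsub>G\<^esub> x i"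
  have "?y = sq_prod n (\<lambda>l. (if l = i then 1 else - 1) * (if l = j then k else 0))"
    unfolding sq_prod_single[OF assms(2), symmetric] by (rule conj_sq_prod(2)[OF assms(1)])
  also have "\<dots> = sq_prod n (\<lambda>l. - (if l = j then k else 0))"
    using assms by (intro sq_prod_cong) auto
  also have "\<dots> = inv\<^bsub>G\<^esub> (q j [^]\<^bsub>G\<^esub> k)"
    unfolding sq_prod_uminus sq_prod_single[OF assms(2)] ..
  finally have y: "?y = inv\<^bsub>G\<^esub> (q j [^]\<^bsub>G\<^esub> k)" .
  have "inv\<^bsub>G\<^esub> (q j [^]\<^bsub>G\<^esub> k) \<in> A"
    using subgroup.m_inv_closed[OF A_subgroup A_int_pow] assms by simp
  then have comm: "?y \<otimes>\<^bsub>G\<^esub> sq_prod n c = sq_prod n c \<otimes>\<^bsub>G\<^esub> ?y"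
    unfolding y by (rule A_commute) simp
  have "inv\<^bsub>G\<^esub> (x i \<otimes>\<^bsub>G\<^esub> sq_prod n c) \<otimes>\<^bsub>G\<^esub> q j [^]\<^bsub>G\<^esub> k \<otimes>\<^bsub>G\<^esub> (x i \<otimes>\<^bsub>G\<^esub> sq_prod n c) =
      inv\<^bsub>G\<^esub> sq_prod n c \<otimes>\<^bsub>G\<^esub> (?y \<otimes>\<^bsub>G\<^esub> sq_prod n c)"
    using assms by (simp add: inv_mult_group m_assoc)
  also have "\<dots> = inv\<^bsub>G\<^esub> sq_prod n c \<otimes>\<^bsub>G\<^esub> sq_prod n c \<otimes>\<^bsub>G\<^esub> ?y"
    unfolding comm using assms by (simp only: m_assoc m_closed inv_closed sq_prod_closed int_pow_closed q_closed x_closed)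
  also have "\<dots> = ?y"
    using assms by simp
  finally show ?thesis unfolding y .
qed

lemma t_map_eqI:
  assumes "f \<in> hom G G" "f \<in> extensional (carrier G)"
    and "\<And>i. i < n \<Longrightarrow> f (x i) = x i \<otimes>\<^bsub>G\<^esub> sq_prod n (\<lambda>j. a $$ (i, j))"
  shows "t_map n a = f"
  unfolding t_map_def
proof (rule the_equality)
  fix g assume g: "g \<in> hom G G \<and> g \<in> extensional (carrier G) \<and>
    (\<forall>i<n. g (x i) = x i \<otimes>\<^bsub>G\<^esub> sq_prod n (\<lambda>j. a $$ (i, j)))"
  show "g = f"
  proof (rule extensionalityI[of _ "carrier G"])
    fix y assume y: "y \<in> carrier G"
    show "g y = f y"
      by (rule G_hom_eqI[OF group_axioms _ _ _ y]) (use g assms in simp_all)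
  qed (use g assms in simp_all)
qed (use assms in simp)

lemma t_map_spec:
  shows t_map_hom: "group_hom G G (t_map n a)"
    and t_map_extensional: "t_map n a \<in> extensional (carrier G)"
    and t_map_x: "i < n \<Longrightarrow> t_map n a (x i) = x i \<otimes>\<^bsub>G\<^esub> sq_prod n (\<lambda>j. a $$ (i, j))"
proof -
  let ?f = "\<lambda>i. x i \<otimes>\<^bsub>G\<^esub> sq_prod n (\<lambda>j. a $$ (i, j))"
  obtain F where F: "F \<in> hom G G" "\<And>i. i < n \<Longrightarrow> F (x i) = ?f i"
    by (rule G_hom_exists[OF group_axioms, of ?f])
      (simp_all add: square_x_sq_prod conj_x_sq_prod_q_pow)
  let ?F = "restrict F (carrier G)"
  have "?F \<in> hom G G" using F(1) by (auto simp: hom_def)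
  moreover have "?F (x i) = ?f i" if "i < n" for i using F(2) that by simp
  ultimately have "t_map n a = ?F" by (intro t_map_eqI) simp_all
  then show "group_hom G G (t_map n a)" "t_map n a \<in> extensional (carrier G)"
    "i < n \<Longrightarrow> t_map n a (x i) = ?f i"
    using \<open>?F \<in> hom G G\<close> F(2) by (simp_all add: group_hom_def group_hom_axioms_def)
qed

text \<open>On \<open>A\<close> the endomorphism is diagonal, which explains the operation of \<open>M\<close>.\<close>

lemma t_map_sq_prod: "t_map n a (sq_prod n c) = sq_prod n (\<lambda>j. (1 + 2 * a $$ (j, j)) * c j)"
proof (rule hom_sq_prod_powers[OF t_map_hom])
  interpret t: group_hom G G "t_map n a" by (rule t_map_hom)
  fix j assume j: "j < n"
  have "t_map n a (q j) = t_map n a (x j) \<otimes>\<^bsub>G\<^esub> t_map n a (x j)"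
    using j by (simp add: q_eq)
  also have "\<dots> = q j [^]\<^bsub>G\<^esub> (1 + 2 * a $$ (j, j))"
    using j by (simp only: t_map_x square_x_sq_prod)
  finally show "t_map n a (q j) = q j [^]\<^bsub>G\<^esub> (1 + 2 * a $$ (j, j))" .
qed

lemma t_map_mult: "t_map n (a \<otimes>\<^bsub>M_monoid n\<^esub> b) = compose (carrier G) (t_map n a) (t_map n b)"
proof (rule t_map_eqI)
  interpret ta: group_hom G G "t_map n a" by (rule t_map_hom)
  interpret tb: group_hom G G "t_map n b" by (rule t_map_hom)
  show "compose (carrier G) (t_map n a) (t_map n b) \<in> hom G G"
    by (rule hom_compose[OF tb.homh ta.homh])
  fix i assume i: "i < n"
  have "sq_prod n (\<lambda>j. (a \<otimes>\<^bsub>M_monoid n\<^esub> b) $$ (i, j)) =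
      sq_prod n (\<lambda>j. a $$ (i, j)) \<otimes>\<^bsub>G\<^esub> sq_prod n (\<lambda>j. (1 + 2 * a $$ (j, j)) * b $$ (i, j))"
    unfolding sq_prod_add[symmetric] using i by (intro sq_prod_cong) simp
  then show "compose (carrier G) (t_map n a) (t_map n b) (x i) =
      x i \<otimes>\<^bsub>G\<^esub> sq_prod n (\<lambda>j. (a \<otimes>\<^bsub>M_monoid n\<^esub> b) $$ (i, j))"
    using i by (simp add: compose_def t_map_x t_map_sq_prod m_assoc)
qed (simp add: compose_def)

lemma t_map_zero: "t_map n (0\<^sub>m n n) = (\<lambda>y\<in>carrier G. y)"
proof (rule t_map_eqI)
  fix i assume i: "i < n"
  have "sq_prod n (\<lambda>j. 0\<^sub>m n n $$ (i, j)) = \<one>\<^bsub>G\<^esub>"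
    unfolding sq_prod_zero[symmetric] using i by (intro sq_prod_cong) simp
  then show "(\<lambda>y\<in>carrier G. y) (x i) = x i \<otimes>\<^bsub>G\<^esub> sq_prod n (\<lambda>j. 0\<^sub>m n n $$ (i, j))"
    using i by simp
qed (auto simp: hom_def)

lemma t_map_inject:
  assumes "t_map n a = t_map n b" "a \<in> carrier_mat n n" "b \<in> carrier_mat n n"
  shows "a = b"
proof (rule eq_matI)
  fix i j assume "i < dim_row b" "j < dim_col b"
  then have ij: "i < n" "j < n" using assms by auto
  then have "x i \<otimes>\<^bsub>G\<^esub> sq_prod n (\<lambda>j. a $$ (i, j)) = x i \<otimes>\<^bsub>G\<^esub> sq_prod n (\<lambda>j. b $$ (i, j))"
    using t_map_x[of i a] t_map_x[of i b] assms(1) by simp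
  then have "sq_prod n (\<lambda>j. a $$ (i, j)) = sq_prod n (\<lambda>j. b $$ (i, j))"
    using ij by simp
  then show "a $$ (i, j) = b $$ (i, j)"
    using ij(2) by (rule sq_prod_inject)
qed (use assms in auto)

lemma t_map_automorphism:
  assumes "a \<in> carrier (M_units n)"
  shows "t_map n a \<in> carrier (AutoGroup G)"
proof -
  obtain b where ab: "a \<otimes>\<^bsub>M_monoid n\<^esub> b = 0\<^sub>m n n" "b \<otimes>\<^bsub>M_monoid n\<^esub> a = 0\<^sub>m n n"
    using assms by (auto simp: M_units_simps Units_def M_monoid_simps)
  interpret ta: group_hom G G "t_map n a" by (rule t_map_hom)
  interpret tb: group_hom G G "t_map n b" by (rule t_map_hom)
  have "t_map n a (t_map n b y) = y" "t_map n b (t_map n a y) = y" if "y \<in> carrier G" for y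
    using t_map_mult[of a b] t_map_mult[of b a] that
    by (simp_all add: ab t_map_zero compose_def restrict_def fun_eq_iff) metis+
  then have "bij_betw (t_map n a) (carrier G) (carrier G)"
    by (intro bij_betwI[where g = "t_map n b"]) auto
  then show ?thesis
    using t_map_extensional ta.homh by (simp add: carrier_AutoGroup_iff)
qed

lemma t_map_group_hom: "group_hom (M_units n) (AutoGroup G) (t_map n)"
  using M_units_group AutoGroup
  by (auto simp: group_hom_def group_hom_axioms_def hom_def t_map_automorphism AutoGroup_mult
      M_units_simps(2) t_map_mult)

lemma t_map_inj: "inj_on (t_map n) (carrier (M_units n))"
  by (intro inj_onI t_map_inject M_units_carrier_mat)

section \<open>The map \<open>\<iota>\<close>\<close>

lemma iota_sq_prod: "iota n (sq_prod n c) = mat n n (\<lambda>(i, j). if i = j then 0 else - 2 * c j)"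
  unfolding iota_def
proof (rule the_equality)
  fix m assume "\<exists>d. sq_prod n c = sq_prod n d \<and> m = mat n n (\<lambda>(i, j). if i = j then 0 else - 2 * d j)"
  then obtain d where d: "sq_prod n c = sq_prod n d"
    "m = mat n n (\<lambda>(i, j). if i = j then 0 else - 2 * d j)" by blast
  show "m = mat n n (\<lambda>(i, j). if i = j then 0 else - 2 * c j)"
    unfolding d(2) using sq_prod_inject[OF d(1)] by (intro eq_matI) auto
qed blast

lemma iota_mult:
  assumes "a \<in> A" "b \<in> A"
  shows "iota n (a \<otimes>\<^bsub>G\<^esub> b) = iota n a \<otimes>\<^bsub>M_monoid n\<^esub> iota n b"
proof -
  obtain c where c: "a = sq_prod n c" using assms(1) by (rule A_cases)
  obtain d where d: "b = sq_prod n d" using assms(2) by (rule A_cases)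
  show ?thesis
    unfolding c d sq_prod_add[symmetric] iota_sq_prod
    by (intro eq_matI) (auto simp: M_monoid_def)
qed

lemma iota_one: "iota n \<one>\<^bsub>G\<^esub> = 0\<^sub>m n n"
  unfolding sq_prod_zero[symmetric] iota_sq_prod by (intro eq_matI) auto

lemma iota_carrier_mat: "a \<in> A \<Longrightarrow> iota n a \<in> carrier_mat n n"
  by (erule A_cases) (simp add: iota_sq_prod)

lemma iota_unit:
  assumes "a \<in> A"
  shows "iota n a \<in> carrier (M_units n)"
proof (rule M_unitI)
  have "inv\<^bsub>G\<^esub> a \<in> A" using assms A_subgroup by (simp add: subgroup.m_inv_closed)
  then show "iota n a \<otimes>\<^bsub>M_monoid n\<^esub> iota n (inv\<^bsub>G\<^esub> a) = 0\<^sub>m n n"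
    "iota n (inv\<^bsub>G\<^esub> a) \<otimes>\<^bsub>M_monoid n\<^esub> iota n a = 0\<^sub>m n n" "iota n (inv\<^bsub>G\<^esub> a) \<in> carrier_mat n n"
    using assms A_carrier by (simp_all add: iota_one iota_carrier_mat flip: iota_mult)
qed (use assms in \<open>rule iota_carrier_mat\<close>)

lemma A_group_group: "group (A_group n)"
  unfolding A_group_def by (rule subgroup_imp_group[OF A_subgroup])

lemma carrier_A_group [simp]: "carrier (A_group n) = A"
  by (simp add: A_group_def)

lemma iota_group_hom: "group_hom (A_group n) (M_units n) (iota n)"
  using A_group_group M_units_group
  by (simp add: group_hom_def group_hom_axioms_def hom_def A_group_def iota_unit iota_mult M_units_simps(2))

lemma t_map_iota:
  assumes "a \<in> A"
  shows "t_map n (iota n a) = conj_aut G a"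
proof (rule t_map_eqI)
  show "conj_aut G a \<in> hom G G" "conj_aut G a \<in> extensional (carrier G)"
    using conj_aut_carrier[OF A_carrier[OF assms]] by (simp_all add: carrier_AutoGroup_iff)
  fix i assume i: "i < n"
  obtain c where c: "a = sq_prod n c" using assms by (rule A_cases)
  have "sq_prod n (\<lambda>j. iota n a $$ (i, j)) =
      sq_prod n (\<lambda>j. (if j = i then 1 else - 1) * c j) \<otimes>\<^bsub>G\<^esub> sq_prod n (\<lambda>j. - c j)"
    unfolding sq_prod_add[symmetric] c iota_sq_prod using i by (intro sq_prod_cong) auto
  also have "\<dots> = inv\<^bsub>G\<^esub> x i \<otimes>\<^bsub>G\<^esub> a \<otimes>\<^bsub>G\<^esub> x i \<otimes>\<^bsub>G\<^esub> inv\<^bsub>G\<^esub> a"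
    using i by (simp only: c conj_sq_prod sq_prod_uminus)
  finally have "x i \<otimes>\<^bsub>G\<^esub> sq_prod n (\<lambda>j. iota n a $$ (i, j)) = x i \<otimes>\<^bsub>G\<^esub> inv\<^bsub>G\<^esub> x i \<otimes>\<^bsub>G\<^esub> (a \<otimes>\<^bsub>G\<^esub> x i \<otimes>\<^bsub>G\<^esub> inv\<^bsub>G\<^esub> a)"
    using i A_carrier[OF assms] by (simp only: m_assoc m_closed inv_closed x_closed)
  then show "conj_aut G a (x i) = x i \<otimes>\<^bsub>G\<^esub> sq_prod n (\<lambda>j. iota n a $$ (i, j))"
    using i A_carrier[OF assms] by (simp add: conj_aut_def)
qed

text \<open>Since \<open>t\<close> is injective, this follows from \<open>t\<^sub>m \<circ> conj\<^sub>a \<circ> t\<^sub>m\<^sup>-\<^sup>1 = conj\<^sub>b\<close>, where \<open>b = t\<^sub>m(a) \<in> A\<close>.\<close>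

lemma iota_image_normal: "iota_image n \<lhd> M_units n"
proof -
  interpret M: group "M_units n" by (rule M_units_group)
  interpret i: group_hom "A_group n" "M_units n" "iota n" by (rule iota_group_hom)
  interpret t: group_hom "M_units n" "AutoGroup G" "t_map n" by (rule t_map_group_hom)
  show ?thesis
    unfolding M.normal_inv_iff
  proof (intro conjI ballI)
    show "subgroup (iota_image n) (M_units n)"
      using i.img_is_subgroup by (simp add: iota_image_def A_group_def)
    fix m u assume m: "m \<in> carrier (M_units n)" and "u \<in> iota_image n"
    then obtain a where a: "a \<in> A" "u = iota n a" by (auto simp: iota_image_def)
    have "t_map n m a \<in> A"
      using a(1) by (rule A_cases) (simp add: t_map_sq_prod)
    have "t_map n (m \<otimes>\<^bsub>M_units n\<^esub> u \<otimes>\<^bsub>M_units n\<^esub> inv\<^bsub>M_units n\<^esub> m) = t_map n (iota n (t_map n m a))"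
      using m a iota_unit \<open>t_map n m a \<in> A\<close> A_carrier AutoGroup_conj_aut[OF t_map_automorphism[OF m], of a]
      by (simp add: t_map_iota)
    then have "m \<otimes>\<^bsub>M_units n\<^esub> u \<otimes>\<^bsub>M_units n\<^esub> inv\<^bsub>M_units n\<^esub> m = iota n (t_map n m a)"
      using m a iota_unit \<open>t_map n m a \<in> A\<close> by (intro inj_onD[OF t_map_inj]) auto
    then show "m \<otimes>\<^bsub>M_units n\<^esub> u \<otimes>\<^bsub>M_units n\<^esub> inv\<^bsub>M_units n\<^esub> m \<in> iota_image n"
      using \<open>t_map n m a \<in> A\<close> by (simp add: iota_image_def)
  qed
qed

end

section \<open>The subgroup \<open>A\<close> is characteristic\<close>

locale inverting_squares_three = inverting_squares +
  assumes n_ge_3: "3 \<le> n"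
begin

lemma W_free_product_three: "free_product_of_three_involutions W {..<n} (\<lambda>i. w (x i))"
  using W_free_product n_ge_3
  by (simp add: free_product_of_three_involutions_def free_product_of_three_involutions_axioms_def)

text \<open>The image of \<open>\<phi>(A)\<close> in \<open>W\<close> is an abelian normal subgroup, hence trivial. The inverse
  automorphism gives the other inclusion.\<close>

lemma automorphism_image_A_subset:
  assumes \<phi>: "\<phi> \<in> carrier (AutoGroup G)"
  shows "\<phi> ` A \<subseteq> A"
proof -
  interpret \<phi>: group_hom G G \<phi> by (rule AutoGroup_group_hom[OF group_axioms \<phi>])
  interpret w: group_hom G W w by (rule w_group_hom)
  interpret W: free_product_of_three_involutions W "{..<n}" "\<lambda>i. w (x i)"
    by (rule W_free_product_three)
  have hom: "group_hom G W (w \<circ> \<phi>)"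
    using Group.hom_compose[OF \<phi>.homh w.homh] by (simp add: group_hom_def group_hom_axioms_def)
  have "(w \<circ> \<phi>) ` carrier G = carrier W"
    unfolding image_comp[symmetric] using \<phi> by (simp add: carrier_AutoGroup_iff bij_betw_def carrier_W)
  then have normal: "(w \<circ> \<phi>) ` A \<lhd> W"
    by (rule normal.surj_hom_normal_subgroup[OF A_normal hom])
  have "(w \<circ> \<phi>) ` A = {\<one>\<^bsub>W\<^esub>}"
  proof (rule W.trivial_normal_abelian[OF normal])
    fix u v assume "u \<in> (w \<circ> \<phi>) ` A" "v \<in> (w \<circ> \<phi>) ` A"
    then obtain a b where ab: "a \<in> A" "b \<in> A" "u = w (\<phi> a)" "v = w (\<phi> b)" by auto
    have "u \<otimes>\<^bsub>W\<^esub> v = w (\<phi> (a \<otimes>\<^bsub>G\<^esub> b))" "v \<otimes>\<^bsub>W\<^esub> u = w (\<phi> (b \<otimes>\<^bsub>G\<^esub> a))"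
      using ab A_carrier by simp_all
    then show "u \<otimes>\<^bsub>W\<^esub> v = v \<otimes>\<^bsub>W\<^esub> u"
      using A_commute[OF ab(1,2)] by simp
  qed
  then show ?thesis
    using A_carrier by (auto simp: w_eq_one_iff[symmetric])
qed

lemma other_index: "\<exists>i<n. i \<noteq> j"
  using n_ge_3 by (intro exI[of _ "if j = 0 then 1 else 0"]) auto

text \<open>A central element lies in \<open>A\<close>, because \<open>W\<close> has trivial centre. Each of its coordinates is inverted by some
  generator, so it is zero.\<close>

lemma trivial_centre_G:
  assumes z: "z \<in> carrier G" and central: "\<forall>h\<in>carrier G. z \<otimes>\<^bsub>G\<^esub> h = h \<otimes>\<^bsub>G\<^esub> z"
  shows "z = \<one>\<^bsub>G\<^esub>"
proof -
  interpret w: group_hom G W w by (rule w_group_hom)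
  interpret W: free_product_of_three_involutions W "{..<n}" "\<lambda>i. w (x i)"
    by (rule W_free_product_three)
  have "w z = \<one>\<^bsub>W\<^esub>"
  proof (rule W.trivial_centre)
    show "\<forall>h\<in>carrier W. w z \<otimes>\<^bsub>W\<^esub> h = h \<otimes>\<^bsub>W\<^esub> w z"
    proof
      fix h assume "h \<in> carrier W"
      then obtain g where g: "g \<in> carrier G" "h = w g" by (auto simp: carrier_W)
      have "w (z \<otimes>\<^bsub>G\<^esub> g) = w (g \<otimes>\<^bsub>G\<^esub> z)" using central g(1) by simp
      then show "w z \<otimes>\<^bsub>W\<^esub> h = h \<otimes>\<^bsub>W\<^esub> w z" using z g by simp
    qed
  qed (use z in simp)
  then have "z \<in> A" using z by (simp add: w_eq_one_iff)
  then obtain c where c: "z = sq_prod n c" by (rule A_cases)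
  have "c j = 0" if j: "j < n" for j
  proof -
    obtain i where i: "i < n" "i \<noteq> j"
      using other_index by blast
    have "x i \<otimes>\<^bsub>G\<^esub> z \<otimes>\<^bsub>G\<^esub> inv\<^bsub>G\<^esub> x i = z"
    proof -
      have "x i \<otimes>\<^bsub>G\<^esub> z = z \<otimes>\<^bsub>G\<^esub> x i" using central i(1) by simp
      then show ?thesis using z i(1) by (simp add: m_assoc)
    qed
    then have "sq_prod n (\<lambda>j. (if j = i then 1 else - 1) * c j) = sq_prod n c"
      using conj_sq_prod(1)[OF i(1), of c] c by simp
    from sq_prod_inject[OF this j] i(2) show ?thesis by simp
  qed
  then have "sq_prod n c = sq_prod n (\<lambda>j. 0)" by (intro sq_prod_cong) simp
  then show ?thesis using c by (simp add: sq_prod_zero)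
qed

section \<open>The map \<open>\<pi>\<close>\<close>

lemma pi_map_w:
  assumes "\<phi> \<in> carrier (AutoGroup G)" "g \<in> carrier G"
  shows "pi_map n \<phi> (w g) = w (\<phi> g)"
  unfolding pi_map_def
  using assms
  by (intro induced_map_quot[OF A_normal A_normal] automorphism_image_A_subset
      AutoGroup_group_hom[OF group_axioms])

lemma pi_map_mult:
  assumes "\<phi> \<in> carrier (AutoGroup G)" "\<psi> \<in> carrier (AutoGroup G)"
  shows "pi_map n (\<phi> \<otimes>\<^bsub>AutoGroup G\<^esub> \<psi>) = compose (carrier W) (pi_map n \<phi>) (pi_map n \<psi>)"
proof (rule extensionalityI[of _ "carrier W"])
  interpret Aut: group "AutoGroup G" by (rule AutoGroup)
  interpret \<psi>: group_hom G G \<psi> by (rule AutoGroup_group_hom[OF group_axioms assms(2)])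
  fix u assume "u \<in> carrier W"
  then obtain g where g: "g \<in> carrier G" "u = w g" by (auto simp: carrier_W)
  have "pi_map n (\<phi> \<otimes>\<^bsub>AutoGroup G\<^esub> \<psi>) u = w ((\<phi> \<otimes>\<^bsub>AutoGroup G\<^esub> \<psi>) g)"
    using assms g pi_map_w[OF Aut.m_closed[OF assms]] by simp
  also have "\<dots> = w (\<phi> (\<psi> g))"
    using g by (simp add: AutoGroup_mult[OF assms] compose_def)
  finally show "pi_map n (\<phi> \<otimes>\<^bsub>AutoGroup G\<^esub> \<psi>) u = compose (carrier W) (pi_map n \<phi>) (pi_map n \<psi>) u"
    using assms g \<open>u \<in> carrier W\<close> by (simp add: compose_def pi_map_w)
qed (simp_all add: pi_map_def induced_map_def W_group_def)

lemma pi_map_one: "pi_map n \<one>\<^bsub>AutoGroup G\<^esub> = (\<lambda>u\<in>carrier W. u)"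
proof (rule extensionalityI[of _ "carrier W"])
  fix u assume u: "u \<in> carrier W"
  then obtain g where g: "g \<in> carrier G" "u = w g" by (auto simp: carrier_W)
  have "pi_map n \<one>\<^bsub>AutoGroup G\<^esub> (w g) = w (\<one>\<^bsub>AutoGroup G\<^esub> g)"
    using g(1) by (intro pi_map_w group.is_monoid[OF AutoGroup, THEN monoid.one_closed])
  then show "pi_map n \<one>\<^bsub>AutoGroup G\<^esub> u = (\<lambda>u\<in>carrier W. u) u"
    using u g by (simp add: AutoGroup_one)
qed (simp_all add: pi_map_def induced_map_def W_group_def)

lemma pi_map_automorphism:
  assumes \<phi>: "\<phi> \<in> carrier (AutoGroup G)"
  shows "pi_map n \<phi> \<in> carrier (AutoGroup W)"
proof -
  interpret Aut: group "AutoGroup G" by (rule AutoGroup)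
  have hom: "group_hom W W (pi_map n \<theta>)" if "\<theta> \<in> carrier (AutoGroup G)" for \<theta>
    unfolding W_group_def pi_map_def using that
    by (intro induced_map_group_hom[OF A_normal A_normal] automorphism_image_A_subset
        AutoGroup_group_hom[OF group_axioms])
  let ?\<theta> = "inv\<^bsub>AutoGroup G\<^esub> \<phi>"
  have \<theta>: "?\<theta> \<in> carrier (AutoGroup G)" using \<phi> by simp
  have 1: "compose (carrier W) (pi_map n \<phi>) (pi_map n ?\<theta>) = (\<lambda>u\<in>carrier W. u)"
    using pi_map_mult[OF \<phi> \<theta>] \<phi> by (simp add: pi_map_one)
  have 2: "compose (carrier W) (pi_map n ?\<theta>) (pi_map n \<phi>) = (\<lambda>u\<in>carrier W. u)"
    using pi_map_mult[OF \<theta> \<phi>] \<phi> by (simp add: pi_map_one)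
  have "pi_map n \<phi> (pi_map n ?\<theta> u) = u" "pi_map n ?\<theta> (pi_map n \<phi> u) = u" if "u \<in> carrier W" for u
    using fun_cong[OF 1, of u] fun_cong[OF 2, of u] that by (simp_all add: compose_def)
  then have "bij_betw (pi_map n \<phi>) (carrier W) (carrier W)"
    using group_hom.hom_closed[OF hom[OF \<phi>]] group_hom.hom_closed[OF hom[OF \<theta>]]
    by (intro bij_betwI[where g = "pi_map n ?\<theta>"]) auto
  then show ?thesis
    using group_hom.homh[OF hom[OF \<phi>]]
    by (simp add: carrier_AutoGroup_iff pi_map_def induced_map_def W_group_def)
qed

lemma W_group_group: "group W"
  using w_group_hom by (simp add: group_hom_def)

lemma pi_map_group_hom: "group_hom (AutoGroup G) (AutoGroup W) (pi_map n)"
proof -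
  have "pi_map n \<in> hom (AutoGroup G) (AutoGroup W)"
  proof (rule homI)
    fix \<phi> \<psi> assume "\<phi> \<in> carrier (AutoGroup G)" "\<psi> \<in> carrier (AutoGroup G)"
    then show "pi_map n (\<phi> \<otimes>\<^bsub>AutoGroup G\<^esub> \<psi>) = pi_map n \<phi> \<otimes>\<^bsub>AutoGroup W\<^esub> pi_map n \<psi>"
      by (simp only: pi_map_mult AutoGroup_mult[OF pi_map_automorphism pi_map_automorphism])
  qed (rule pi_map_automorphism)
  then show ?thesis
    using AutoGroup group.AutoGroup[OF W_group_group]
    by (simp add: group_hom_def group_hom_axioms_def)
qed

lemma pi_map_conj_aut:
  assumes "g \<in> carrier G"
  shows "pi_map n (conj_aut G g) = conj_aut W (w g)"
proof -
  interpret W: group W by (rule W_group_group)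
  interpret w: group_hom G W w by (rule w_group_hom)
  show ?thesis
  proof (rule AutoGroup_eqI)
    fix u assume "u \<in> carrier W"
    then obtain h where "h \<in> carrier G" "u = w h" by (auto simp: carrier_W)
    with assms show "pi_map n (conj_aut G g) u = conj_aut W (w g) u"
      by (simp add: pi_map_w conj_aut_carrier) (simp add: conj_aut_def)
  qed (use assms in \<open>simp_all add: pi_map_automorphism conj_aut_carrier W.conj_aut_carrier\<close>)
qed

lemma pi_map_t_map:
  assumes a: "a \<in> carrier (M_units n)"
  shows "pi_map n (t_map n a) = \<one>\<^bsub>AutoGroup W\<^esub>"
  unfolding AutoGroup_one
proof (rule extensionalityI[of _ "carrier W"])
  interpret t: group_hom G G "t_map n a" by (rule t_map_hom)
  interpret w: group_hom G W w by (rule w_group_hom)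
  fix u assume u: "u \<in> carrier W"
  then obtain g where g: "g \<in> carrier G" "u = w g" by (auto simp: carrier_W)
  have "(w \<circ> t_map n a) g = w g"
  proof (rule G_hom_eqI[OF W_group_group _ _ _ g(1)])
    show "w \<circ> t_map n a \<in> hom G W" by (rule Group.hom_compose[OF t.homh w.homh])
    show "(w \<circ> t_map n a) (x i) = w (x i)" if "i < n" for i
      using that w_eq_one_iff[of "sq_prod n (\<lambda>j. a $$ (i, j))"] by (simp add: t_map_x)
  qed (rule w.homh)
  then show "pi_map n (t_map n a) u = (\<lambda>u\<in>carrier W. u) u"
    using u g pi_map_w[OF t_map_automorphism[OF a]] by simp
qed (simp_all add: pi_map_def induced_map_def W_group_def)

text \<open>Such an automorphism moves each \<open>x\<^sub>i\<close> by an element of \<open>A\<close>; its exponents form the \<open>i\<close>-th row.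
  That the matrix is a unit needs the same fact for the inverse automorphism.\<close>

lemma pi_map_kernel_matrix:
  assumes \<phi>: "\<phi> \<in> carrier (AutoGroup G)" and triv: "pi_map n \<phi> = \<one>\<^bsub>AutoGroup W\<^esub>"
  shows "\<exists>a \<in> carrier_mat n n. \<phi> = t_map n a"
proof -
  interpret \<phi>: group_hom G G \<phi> by (rule AutoGroup_group_hom[OF group_axioms \<phi>])
  interpret w: group_hom G W w by (rule w_group_hom)
  have "\<exists>c. \<phi> (x i) = x i \<otimes>\<^bsub>G\<^esub> sq_prod n c" if i: "i < n" for i
  proof -
    have "w (\<phi> (x i)) = w (x i)"
      using pi_map_w[OF \<phi>, of "x i"] i by (simp add: triv AutoGroup_one)
    then obtain a where a: "a \<in> A" "\<phi> (x i) = x i \<otimes>\<^bsub>G\<^esub> a"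
      using w_eq_iff[of "\<phi> (x i)" "x i"] i by auto
    from a(1) obtain c where "a = sq_prod n c" by (rule A_cases)
    with a(2) show ?thesis by blast
  qed
  then obtain c where c: "\<And>i. i < n \<Longrightarrow> \<phi> (x i) = x i \<otimes>\<^bsub>G\<^esub> sq_prod n (c i)" by metis
  let ?a = "mat n n (\<lambda>(i, j). c i j)"
  have "t_map n ?a = \<phi>"
  proof (rule t_map_eqI)
    fix i assume i: "i < n"
    have "sq_prod n (c i) = sq_prod n (\<lambda>j. ?a $$ (i, j))"
      using i by (intro sq_prod_cong) simp
    with c[OF i] show "\<phi> (x i) = x i \<otimes>\<^bsub>G\<^esub> sq_prod n (\<lambda>j. ?a $$ (i, j))" by simp
  qed (use \<phi> in \<open>simp_all add: carrier_AutoGroup_iff\<close>)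
  then show ?thesis by (intro bexI[of _ ?a]) simp_all
qed

lemma pi_map_kernel: "kernel (AutoGroup G) (AutoGroup W) (pi_map n) = t_map n ` carrier (M_units n)"
proof
  show "t_map n ` carrier (M_units n) \<subseteq> kernel (AutoGroup G) (AutoGroup W) (pi_map n)"
    using t_map_automorphism pi_map_t_map by (auto simp: kernel_def)
  show "kernel (AutoGroup G) (AutoGroup W) (pi_map n) \<subseteq> t_map n ` carrier (M_units n)"
  proof
    interpret Aut: group "AutoGroup G" by (rule AutoGroup)
    interpret \<pi>: group_hom "AutoGroup G" "AutoGroup W" "pi_map n" by (rule pi_map_group_hom)
    fix \<phi> assume "\<phi> \<in> kernel (AutoGroup G) (AutoGroup W) (pi_map n)"
    then have \<phi>: "\<phi> \<in> carrier (AutoGroup G)" and triv: "pi_map n \<phi> = \<one>\<^bsub>AutoGroup W\<^esub>"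
      by (simp_all add: kernel_def)
    let ?\<theta> = "inv\<^bsub>AutoGroup G\<^esub> \<phi>"
    have \<theta>: "?\<theta> \<in> carrier (AutoGroup G)" using \<phi> by simp
    obtain a where a: "a \<in> carrier_mat n n" "\<phi> = t_map n a"
      using pi_map_kernel_matrix[OF \<phi> triv] by blast
    obtain b where b: "b \<in> carrier_mat n n" "?\<theta> = t_map n b"
      using pi_map_kernel_matrix[OF \<theta>] \<phi> triv by auto
    have "t_map n (a \<otimes>\<^bsub>M_monoid n\<^esub> b) = t_map n (0\<^sub>m n n)"
      using Aut.r_inv[OF \<phi>] by (simp add: AutoGroup_mult[OF \<phi> \<theta>] t_map_mult t_map_zero AutoGroup_one a(2)[symmetric] b(2)[symmetric])
    moreover have "t_map n (b \<otimes>\<^bsub>M_monoid n\<^esub> a) = t_map n (0\<^sub>m n n)"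
      using Aut.l_inv[OF \<phi>] by (simp add: AutoGroup_mult[OF \<theta> \<phi>] t_map_mult t_map_zero AutoGroup_one a(2)[symmetric] b(2)[symmetric])
    ultimately have "a \<in> carrier (M_units n)"
      using a(1) b(1) by (intro M_unitI[of _ _ b] t_map_inject) simp_all
    with a(2) show "\<phi> \<in> t_map n ` carrier (M_units n)" by blast
  qed
qed

text \<open>The sign by which \<open>g x\<^sub>i g\<^sup>-\<^sup>1\<close> acts on \<open>q\<^sub>j\<close> is the one by which \<open>x\<^sub>i\<close> does.\<close>

lemma conj_x_conj_q:
  assumes g: "g \<in> carrier G" and ij: "i < n" "j < n" "i \<noteq> j"
    and y: "y \<in> {q j, inv\<^bsub>G\<^esub> q j}"
  shows "inv\<^bsub>G\<^esub> (g \<otimes>\<^bsub>G\<^esub> x i \<otimes>\<^bsub>G\<^esub> inv\<^bsub>G\<^esub> g) \<otimes>\<^bsub>G\<^esub> y \<otimes>\<^bsub>G\<^esub> (g \<otimes>\<^bsub>G\<^esub> x i \<otimes>\<^bsub>G\<^esub> inv\<^bsub>G\<^esub> g) = inv\<^bsub>G\<^esub> y"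
proof -
  have yc: "y \<in> carrier G" using y ij by auto
  let ?u = "inv\<^bsub>G\<^esub> g \<otimes>\<^bsub>G\<^esub> y \<otimes>\<^bsub>G\<^esub> g"
  have "?u = q j \<or> ?u = inv\<^bsub>G\<^esub> q j"
    using y g ij conj_q[of "inv\<^bsub>G\<^esub> g" j] conj_inv[of "inv\<^bsub>G\<^esub> g" "q j"] by auto
  then have u: "inv\<^bsub>G\<^esub> x i \<otimes>\<^bsub>G\<^esub> ?u \<otimes>\<^bsub>G\<^esub> x i = inv\<^bsub>G\<^esub> ?u"
    using ij conj_x_q(1)[of i j] conj_inv[of "inv\<^bsub>G\<^esub> x i" "q j"] by auto
  have "inv\<^bsub>G\<^esub> (g \<otimes>\<^bsub>G\<^esub> x i \<otimes>\<^bsub>G\<^esub> inv\<^bsub>G\<^esub> g) \<otimes>\<^bsub>G\<^esub> y \<otimes>\<^bsub>G\<^esub> (g \<otimes>\<^bsub>G\<^esub> x i \<otimes>\<^bsub>G\<^esub> inv\<^bsub>G\<^esub> g) =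
      g \<otimes>\<^bsub>G\<^esub> (inv\<^bsub>G\<^esub> x i \<otimes>\<^bsub>G\<^esub> ?u \<otimes>\<^bsub>G\<^esub> x i) \<otimes>\<^bsub>G\<^esub> inv\<^bsub>G\<^esub> g"
    using g yc ij by (simp add: inv_mult_group m_assoc)
  also have "\<dots> = inv\<^bsub>G\<^esub> y"
  proof -
    have "g \<otimes>\<^bsub>G\<^esub> (inv\<^bsub>G\<^esub> g \<otimes>\<^bsub>G\<^esub> z) = z" if "z \<in> carrier G" for z
      using g that by (simp flip: m_assoc)
    then show ?thesis unfolding u using g yc by (simp add: inv_mult_group m_assoc)
  qed
  finally show ?thesis .
qed

text \<open>The lift \<open>F\<close> sends \<open>x\<^sub>i\<close> to \<open>g\<^sub>i x\<^bsub>\<sigma>(i)\<^esub> g\<^sub>i\<^sup>-\<^sup>1\<close>, where \<open>g\<^sub>i\<close> is any lift of the conjugating element \<open>h\<^sub>i\<close>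
  of \<open>\<psi>\<close>. It induces \<open>\<psi>\<close> on \<open>W\<close> and permutes the \<open>q\<^sub>j\<close> up to sign.\<close>

lemma pi_map_surj:
  assumes \<psi>: "\<psi> \<in> carrier (AutoGroup W)"
  shows "\<exists>\<phi> \<in> carrier (AutoGroup G). pi_map n \<phi> = \<psi>"
proof -
  interpret W: free_product_of_three_involutions W "{..<n}" "\<lambda>i. w (x i)"
    by (rule W_free_product_three)
  interpret w: group_hom G W w by (rule w_group_hom)
  interpret \<psi>: group_hom W W \<psi> by (rule AutoGroup_group_hom[OF W_group_group \<psi>])
  obtain \<sigma> h where \<sigma>: "bij_betw \<sigma> {..<n} {..<n}" and h: "\<And>i. i \<in> {..<n} \<Longrightarrow> h i \<in> carrier W"
    and \<psi>_x: "\<And>i. i \<in> {..<n} \<Longrightarrow> \<psi> (w (x i)) = h i \<otimes>\<^bsub>W\<^esub> w (x (\<sigma> i)) \<otimes>\<^bsub>W\<^esub> inv\<^bsub>W\<^esub> h i"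
    by (rule W.automorphism_permutes_generators[OF \<psi>]) auto
  have \<sigma>_less: "\<sigma> i < n" if "i < n" for i
    using \<sigma> that by (auto simp: bij_betw_def)
  have \<sigma>_neq: "\<sigma> i \<noteq> \<sigma> j" if "i < n" "j < n" "i \<noteq> j" for i j
    using \<sigma> that by (auto simp: bij_betw_def inj_on_def)
  have "\<forall>i\<in>{..<n}. \<exists>g. g \<in> carrier G \<and> h i = w g"
    using h by (auto simp: carrier_W)
  then obtain g where g: "\<And>i. i < n \<Longrightarrow> g i \<in> carrier G" "\<And>i. i < n \<Longrightarrow> h i = w (g i)"
    by (metis lessThan_iff)
  let ?f = "\<lambda>i. g i \<otimes>\<^bsub>G\<^esub> x (\<sigma> i) \<otimes>\<^bsub>G\<^esub> inv\<^bsub>G\<^esub> g i"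
  have ff: "?f j \<otimes>\<^bsub>G\<^esub> ?f j \<in> {q (\<sigma> j), inv\<^bsub>G\<^esub> q (\<sigma> j)}" if j: "j < n" for j
  proof -
    interpret c: group_hom G G "\<lambda>y. g j \<otimes>\<^bsub>G\<^esub> y \<otimes>\<^bsub>G\<^esub> inv\<^bsub>G\<^esub> g j" by (rule conj_group_hom[OF g(1)[OF j]])
    have "?f j \<otimes>\<^bsub>G\<^esub> ?f j = g j \<otimes>\<^bsub>G\<^esub> q (\<sigma> j) \<otimes>\<^bsub>G\<^esub> inv\<^bsub>G\<^esub> g j"
      unfolding q_eq[OF \<sigma>_less[OF j]] using \<sigma>_less[OF j] by (intro c.hom_mult[symmetric]) simp_all
    then show ?thesis using conj_q[OF g(1)[OF j] \<sigma>_less[OF j]] by simp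
  qed
  have closed: "?f i \<in> carrier G" if "i < n" for i using that g \<sigma>_less by simp
  have rel: "inv\<^bsub>G\<^esub> ?f i \<otimes>\<^bsub>G\<^esub> (?f j \<otimes>\<^bsub>G\<^esub> ?f j) \<otimes>\<^bsub>G\<^esub> ?f i = inv\<^bsub>G\<^esub> (?f j \<otimes>\<^bsub>G\<^esub> ?f j)"
    if ij: "i < n" "j < n" "i \<noteq> j" for i j
    by (rule conj_x_conj_q[OF g(1)[OF ij(1)] \<sigma>_less[OF ij(1)] \<sigma>_less[OF ij(2)] \<sigma>_neq[OF ij]
          ff[OF ij(2)]])
  obtain F where F: "F \<in> hom G G" "\<And>i. i < n \<Longrightarrow> F (x i) = ?f i"
    by (rule G_hom_exists[OF group_axioms, of ?f, OF closed rel]) (use that in blast)+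
  interpret F: group_hom G G F using F(1) by (simp add: group_hom_def group_hom_axioms_def)
  have F_q: "F (q j) = q (\<sigma> j) \<or> F (q j) = inv\<^bsub>G\<^esub> q (\<sigma> j)" if "j < n" for j
    using ff[OF that] that by (simp add: q_eq[of j] F(2))
  have wF: "w (F y) = \<psi> (w y)" if y: "y \<in> carrier G" for y
  proof -
    have "(w \<circ> F) y = (\<psi> \<circ> w) y"
    proof (rule G_hom_eqI[OF W_group_group _ _ _ y])
      show "w \<circ> F \<in> hom G W" by (rule Group.hom_compose[OF F.homh w.homh])
      show "\<psi> \<circ> w \<in> hom G W" by (rule Group.hom_compose[OF w.homh \<psi>.homh])
      show "(w \<circ> F) (x i) = (\<psi> \<circ> w) (x i)" if "i < n" for i
        using that g \<sigma>_less by (simp add: F(2) \<psi>_x)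
    qed
    then show ?thesis by simp
  qed
  have "inj_on F (carrier G)"
    unfolding F.inj_on_one_iff
  proof (intro ballI impI allI)
    fix y assume y: "y \<in> carrier G" "F y = \<one>\<^bsub>G\<^esub>"
    have "\<psi> (w y) = \<psi> \<one>\<^bsub>W\<^esub>"
      unfolding wF[OF y(1), symmetric] y(2) by simp
    moreover have "inj_on \<psi> (carrier W)"
      using \<psi> by (simp add: carrier_AutoGroup_iff bij_betw_def)
    ultimately have "w y = \<one>\<^bsub>W\<^esub>"
      using y(1) inj_onD[of \<psi> "carrier W" "w y" "\<one>\<^bsub>W\<^esub>"] by simp
    then have "y \<in> A" using y(1) by (simp add: w_eq_one_iff)
    then obtain c where c: "y = sq_prod n c" by (rule A_cases)
    \<comment> \<open>\<open>K \<circ> F\<close> kills every \<open>q\<^sub>i\<close> except \<open>q\<^sub>j\<close>, which it sends to a nontrivial translation.\<close>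
    have "c j = 0" if j: "j < n" for j
    proof -
      obtain K where K: "group_hom G dihedral K" "K (q (\<sigma> j)) = (2, False)"
        "\<And>i. i < n \<Longrightarrow> i \<noteq> \<sigma> j \<Longrightarrow> K (q i) = \<one>\<^bsub>dihedral\<^esub>"
        using coordinate_hom_exists[OF \<sigma>_less[OF j]] by blast
      interpret K: group_hom G dihedral K by (rule K(1))
      have KF: "group_hom G dihedral (K \<circ> F)"
        using Group.hom_compose[OF F.homh K.homh] dihedral_group
        by (simp add: group_hom_def group_hom_axioms_def)
      have "(K \<circ> F) (q i) = \<one>\<^bsub>dihedral\<^esub>" if "i < n" "i \<noteq> j" for i
        using F_q[OF that(1)] K(3)[OF \<sigma>_less \<sigma>_neq] that j \<sigma>_less by (auto simp: dihedral_inv)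
      from hom_sq_prod_single[OF KF j this, of c]
      have "K (F (q j)) [^]\<^bsub>dihedral\<^esub> c j = (0, False)"
        using y(2) c by simp
      moreover obtain e where "K (F (q j)) = (e, False)" "e \<noteq> 0"
        using F_q[OF j] \<sigma>_less[OF j] K(2) by (auto simp: dihedral_inv)
      ultimately show ?thesis by (simp add: dihedral_int_pow)
    qed
    then have "sq_prod n c = sq_prod n (\<lambda>j. 0)" by (intro sq_prod_cong) simp
    then show "y = \<one>\<^bsub>G\<^esub>" using c by (simp add: sq_prod_zero)
  qed
  moreover have "F ` carrier G = carrier G"
  proof
    have img: "subgroup (F ` carrier G) G" by (rule F.img_is_subgroup)
    have "A \<subseteq> F ` carrier G"
    proof (rule A_minimal[OF img])
      fix k assume "k < n"
      then obtain j where j: "j < n" "k = \<sigma> j" using \<sigma> by (auto simp: bij_betw_def)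
      have "F (q j) = q k \<or> F (inv\<^bsub>G\<^esub> q j) = q k" using F_q[OF j(1)] j \<sigma>_less by auto
      then have "\<exists>y \<in> {q j, inv\<^bsub>G\<^esub> q j}. q k = F y" by auto
      moreover have "q j \<in> carrier G" "inv\<^bsub>G\<^esub> q j \<in> carrier G" using j(1) by simp_all
      ultimately show "q k \<in> F ` carrier G" by blast
    qed
    show "carrier G \<subseteq> F ` carrier G"
    proof
      fix y assume y: "y \<in> carrier G"
      then have "w y \<in> \<psi> ` w ` carrier G"
        using \<psi> by (simp add: carrier_W[symmetric] carrier_AutoGroup_iff bij_betw_def)
      then obtain z where z: "z \<in> carrier G" "w y = w (F z)" using wF by auto
      then obtain a where a: "a \<in> A" "y = F z \<otimes>\<^bsub>G\<^esub> a" using w_eq_iff[OF y, of "F z"] by auto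
      have "a \<in> F ` carrier G" using \<open>A \<subseteq> F ` carrier G\<close> a(1) by (rule subsetD)
      then show "y \<in> F ` carrier G"
        unfolding a(2) using z(1) by (intro subgroup.m_closed[OF img] imageI)
    qed
  qed auto
  ultimately have bij: "bij_betw F (carrier G) (carrier G)" by (simp add: bij_betw_def)
  let ?\<phi> = "restrict F (carrier G)"
  have "?\<phi> \<in> hom G G" using F(1) by (auto simp: hom_def)
  moreover have "bij_betw ?\<phi> (carrier G) (carrier G)"
    using bij by (rule bij_betw_cong[THEN iffD1, rotated]) simp
  ultimately have \<phi>: "?\<phi> \<in> carrier (AutoGroup G)" by (simp add: carrier_AutoGroup_iff)
  moreover have "pi_map n ?\<phi> = \<psi>"
  proof (rule AutoGroup_eqI[OF pi_map_automorphism[OF \<phi>] \<psi>])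
    fix u assume "u \<in> carrier W"
    then obtain y where "y \<in> carrier G" "u = w y" by (auto simp: carrier_W)
    then show "pi_map n ?\<phi> u = \<psi> u" using pi_map_w[OF \<phi>] wF by simp
  qed
  ultimately show ?thesis by blast
qed

section \<open>The diagram\<close>

lemma row_G: "group_short_exact (A_group n) (\<lambda>a. a) G w W"
  unfolding W_group_def
  using A_group_group A_carrier
  by (intro short_exact_quotient[OF A_normal])
    (auto simp: group_hom_def group_hom_axioms_def hom_def A_group_def)

lemma row_Aut: "group_short_exact (M_units n) (t_map n) (AutoGroup G) (pi_map n) (AutoGroup W)"
proof -
  interpret t: group_hom "M_units n" "AutoGroup G" "t_map n" by (rule t_map_group_hom)
  have "pi_map n ` carrier (AutoGroup G) = carrier (AutoGroup W)"
  proof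
    show "pi_map n ` carrier (AutoGroup G) \<subseteq> carrier (AutoGroup W)"
      using pi_map_automorphism by (rule image_subsetI)
    show "carrier (AutoGroup W) \<subseteq> pi_map n ` carrier (AutoGroup G)"
      using pi_map_surj by (auto simp: image_iff)
  qed
  then show ?thesis
    unfolding group_short_exact_def
    using t_map_group_hom pi_map_group_hom pi_map_kernel t_map_inj
    by (simp add: t.inj_iff_trivial_ker)
qed

lemma column_M: "group_short_exact (A_group n) (iota n) (M_units n)
    (quot_map (M_units n) (iota_image n)) (M_units n Mod iota_image n)"
proof (rule short_exact_quotient[OF iota_image_normal iota_group_hom])
  show "inj_on (iota n) (carrier (A_group n))"
  proof (rule inj_onI)
    fix a b assume "a \<in> carrier (A_group n)" "b \<in> carrier (A_group n)" and eq: "iota n a = iota n b"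
    then have "a \<in> A" "b \<in> A" by simp_all
    from \<open>a \<in> A\<close> obtain c where c: "a = sq_prod n c" by (rule A_cases)
    from \<open>b \<in> A\<close> obtain d where d: "b = sq_prod n d" by (rule A_cases)
    have "c j = d j" if j: "j < n" for j
    proof -
      obtain i where i: "i < n" "i \<noteq> j" using other_index by blast
      have "iota n a $$ (i, j) = iota n b $$ (i, j)" using eq by simp
      then show ?thesis using i j by (simp add: c d iota_sq_prod)
    qed
    then show "a = b" unfolding c d by (rule sq_prod_cong)
  qed
qed (simp add: iota_image_def)

lemma column_G: "group_short_exact G (conj_aut G) (AutoGroup G)
    (quot_map (AutoGroup G) (Inn G)) (OutGroup G)"
  by (rule short_exact_conj_aut[OF trivial_centre_G])

lemma column_W: "group_short_exact W (conj_aut W) (AutoGroup W)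
    (quot_map (AutoGroup W) (Inn W)) (OutGroup W)"
  by (rule group.short_exact_conj_aut[OF W_group_group
        free_product_of_three_involutions.trivial_centre[OF W_free_product_three]])

lemma iota_image_eq: "iota_image n = iota n ` carrier (A_group n)"
  by (simp add: iota_image_def)

lemma row_Out: "group_short_exact (M_units n Mod iota_image n) (t_bar n) (OutGroup G)
    (pi_bar n) (OutGroup W)"
  unfolding t_bar_def pi_bar_def OutGroup_def iota_image_eq Inn_def
proof (rule nine_lemma[OF row_G row_Aut])
  show "iota n ` carrier (A_group n) \<lhd> M_units n"
    using iota_image_normal by (simp add: iota_image_eq)
  show "conj_aut G ` carrier G \<lhd> AutoGroup G"
    using Inn_normal by (simp add: Inn_def)
  show "conj_aut W ` carrier W \<lhd> AutoGroup W"
    using group.Inn_normal[OF W_group_group] by (simp add: Inn_def)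
  show "group_hom W (AutoGroup W) (conj_aut W)"
    by (rule group.conj_aut_group_hom[OF W_group_group])
  then show "inj_on (conj_aut W) (carrier W)"
    using column_W by (simp add: group_short_exact_def group_hom.inj_iff_trivial_ker)
qed (simp_all add: iota_group_hom conj_aut_group_hom t_map_iota pi_map_conj_aut)

end

theorem theorem4p6:
  fixes n :: nat
  assumes "n \<ge> 3"
  shows
    "(\<comment> \<open>rows\<close>
      group_short_exact (A_group n) (\<lambda>a. a) (G_group n) (quot_map (G_group n) (A_set n)) (W_group n) \<and>
      group_short_exact (M_units n) (t_map n) (AutoGroup (G_group n)) (pi_map n)
        (AutoGroup (W_group n)) \<and>
      group_short_exact (M_units n Mod iota_image n) (t_bar n) (OutGroup (G_group n)) (pi_bar n)
        (OutGroup (W_group n))) \<and>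
     (\<comment> \<open>columns\<close>
      group_short_exact (A_group n) (iota n) (M_units n) (quot_map (M_units n) (iota_image n))
        (M_units n Mod iota_image n) \<and>
      group_short_exact (G_group n) (conj_aut (G_group n)) (AutoGroup (G_group n))
        (quot_map (AutoGroup (G_group n)) (Inn (G_group n))) (OutGroup (G_group n)) \<and>
      group_short_exact (W_group n) (conj_aut (W_group n)) (AutoGroup (W_group n))
        (quot_map (AutoGroup (W_group n)) (Inn (W_group n))) (OutGroup (W_group n))) \<and>
     (\<comment> \<open>the four squares\<close>
      (\<forall>a \<in> carrier (A_group n). t_map n (iota n a) = conj_aut (G_group n) a) \<and>
      (\<forall>g \<in> carrier (G_group n).
         pi_map n (conj_aut (G_group n) g) =
         conj_aut (W_group n) (quot_map (G_group n) (A_set n) g)) \<and>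
      (\<forall>m \<in> carrier (M_units n).
         t_bar n (quot_map (M_units n) (iota_image n) m) =
         quot_map (AutoGroup (G_group n)) (Inn (G_group n)) (t_map n m)) \<and>
      (\<forall>\<phi> \<in> carrier (AutoGroup (G_group n)).
         pi_bar n (quot_map (AutoGroup (G_group n)) (Inn (G_group n)) \<phi>) =
         quot_map (AutoGroup (W_group n)) (Inn (W_group n)) (pi_map n \<phi>)))"
proof -
  interpret inverting_squares_three n
    by unfold_locales (rule assms)
  have "t_map n ` iota_image n \<subseteq> Inn (G_group n)"
    using A_carrier by (auto simp: iota_image_def Inn_def t_map_iota)
  then have t: "t_bar n (quot_map (M_units n) (iota_image n) m) =
      quot_map (AutoGroup (G_group n)) (Inn (G_group n)) (t_map n m)" if "m \<in> carrier (M_units n)" for m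
    unfolding t_bar_def
    by (intro induced_map_quot iota_image_normal Inn_normal t_map_group_hom that)
  have "pi_map n ` Inn (G_group n) \<subseteq> Inn (W_group n)"
    by (auto simp: Inn_def pi_map_conj_aut carrier_W)
  then have p: "pi_bar n (quot_map (AutoGroup (G_group n)) (Inn (G_group n)) \<phi>) =
      quot_map (AutoGroup (W_group n)) (Inn (W_group n)) (pi_map n \<phi>)"
    if "\<phi> \<in> carrier (AutoGroup (G_group n))" for \<phi>
    unfolding pi_bar_def
    by (intro induced_map_quot Inn_normal group.Inn_normal[OF W_group_group] pi_map_group_hom that)
  show ?thesis
    using row_G row_Aut row_Out column_M column_G column_W t p t_map_iota pi_map_conj_aut
    by simp
qed

end
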